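(* Let $X$ be a finite-dimensional inner product space over $\mathbb{R}$ (real case) or over $\mathbb{C}$ with Hermitian product (complex case). Let $V\subset X$ be a subspace, $S\subset V$ a Lebesgue measurable set, and $\dim V=p\le q\le n=\dim X$. Then \begin{itemize} \item in the real case, $|S|_p^2 = \binom{n-p}{n-q}^{-1}\cdot \sum_I |S_I|_p^2$; \item in the complex case, $|S|_{2p} = \binom{n-p}{n-q}^{-1}\cdot \sum_I |S_I|_{2p}$; \end{itemize} where the sums run over the orthogonal projections $S_I$ of $S$ on all $q$-dimensional coordinate subspaces $V_I$ of an orthogonal basis of $X$.
   Context: Subspaces, dimension, bases and orthogonality are taken over the same field as $X$. For a basis $(v_1,\ldots,v_n)$ of $X$, $1\le q\le n$, and a multi-index $I=(i_1,\ldots,i_q)$ with $1\le i_1<\cdots<i_q\le n$, let $V_I=\operatorname{span}(v_{i_1},\ldots,v_{i_q})$; these $\binom{n}{q}$ subspaces are the $q$-dimensional coordinate subspaces of the basis. A complex space is also regarded as a real inner product space with inner product $\operatorname{Re}\langle\cdot,\cdot\rangle$. On any real or complex subspace $U\subset X$, $|\cdot|_m$ denotes the $m$-dimensional Lebesgue measure of $U$ if $m=\dim_{\mathbb{R}} U$, and $|\cdot|_m=0$ if $m>\dim_{\mathbb{R}}U$. The measure of a projected set $S_I$ is taken in the subspace which is the orthogonal projection of $V$ on $V_I$. *)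

theory Defs
  imports "HOL-Analysis.Analysis"
begin

section \<open>Finite-dimensional complex inner product spaces\<close>

text \<open>
  A finite-dimensional Hermitian space, regarded at the same time as the real inner product space
  with inner product \<open>Re \<langle>\<cdot>,\<cdot>\<rangle>\<close>; that real structure is the \<^class>\<open>euclidean_space\<close> superclass.
  The Hermitian product is conjugate-linear in its first argument. Its positive definiteness follows
  from that of the real inner product, because \<open>cinner x x\<close> is real by \<open>cinner_commute\<close>.
\<close>

class complex_euclidean_space = euclidean_space +
  fixes scaleC :: "complex \<Rightarrow> 'a \<Rightarrow> 'a" (infixr "*\<^sub>C" 75)
    and cinner :: "'a \<Rightarrow> 'a \<Rightarrow> complex"
  assumes scaleC_add_right: "c *\<^sub>C (x + y) = c *\<^sub>C x + c *\<^sub>C y"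
    and scaleC_add_left: "(c + d) *\<^sub>C x = c *\<^sub>C x + d *\<^sub>C x"
    and scaleC_scaleC: "c *\<^sub>C d *\<^sub>C x = (c * d) *\<^sub>C x"
    and scaleC_one: "1 *\<^sub>C x = x"
    and scaleC_of_real: "complex_of_real r *\<^sub>C x = r *\<^sub>R x"
    and cinner_commute: "cinner x y = cnj (cinner y x)"
    and cinner_add_left: "cinner (x + y) z = cinner x z + cinner y z"
    and cinner_scaleC_left: "cinner (c *\<^sub>C x) y = cnj c * cinner x y"
    and Re_cinner: "Re (cinner x y) = inner x y"

global_interpretation complex_vector:
  vector_space "scaleC :: complex \<Rightarrow> 'a \<Rightarrow> 'a::complex_euclidean_space"
  by standard (simp_all add: scaleC_add_right scaleC_add_left scaleC_scaleC scaleC_one)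

text \<open>The standard spaces \<open>\<complex>\<close> and \<open>\<complex>\<^sup>n\<close>.\<close>

instantiation complex :: complex_euclidean_space
begin
definition "scaleC c (x::complex) = c * x"
definition "cinner x (y::complex) = cnj x * y"
instance
  by standard (simp_all add: scaleC_complex_def cinner_complex_def inner_complex_def
      scaleR_conv_of_real algebra_simps)
end

instantiation vec :: (complex_euclidean_space, finite) complex_euclidean_space
begin
definition "scaleC c (x::'a ^ 'b) = (\<chi> i. c *\<^sub>C (x $ i))"
definition "cinner x (y::'a ^ 'b) = (\<Sum>i\<in>UNIV. cinner (x $ i) (y $ i))"
instance
proof
  fix x y :: "'a ^ 'b"
  show "cinner x y = cnj (cinner y x)"
    unfolding cinner_vec_def cnj_sum by (rule sum.cong[OF refl]) (rule cinner_commute)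
qed (simp_all add: scaleC_vec_def cinner_vec_def vec_eq_iff scaleC_add_right scaleC_add_left
    scaleC_scaleC scaleC_one scaleC_of_real cinner_add_left cinner_scaleC_left Re_cinner
    inner_vec_def sum.distrib sum_distrib_left)
end


section \<open>Lebesgue measure on subspaces\<close>

definition orthonormal_basis_of :: "'a::euclidean_space set \<Rightarrow> 'a set \<Rightarrow> bool" where
  "orthonormal_basis_of U B \<longleftrightarrow> pairwise orthogonal B \<and> (\<forall>b\<in>B. norm b = 1) \<and> span B = U"

text \<open>
  For a real subspace \<open>U\<close>, Lebesgue measure on the coordinates with respect to an orthonormal basis
  of \<open>U\<close> is transported to \<open>U\<close>, in the same way as \<^const>\<open>lborel\<close> is obtained from the
  distinguished basis \<^const>\<open>Basis\<close>. By rotation invariance the choice of the basis is immaterial.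
  For \<open>U = {0}\<close> this is the unit point mass at the origin. The completion gives the Lebesgue
  measurable subsets of \<open>U\<close>. (The library's \<open>lebesgue_on U\<close> is something else: the restriction of
  the full-dimensional measure, which vanishes on proper subspaces.)
\<close>

definition subspace_lborel :: "'a::euclidean_space set \<Rightarrow> 'a measure" where
  "subspace_lborel U =
     (let B = (SOME B. orthonormal_basis_of U B)
      in distr (\<Pi>\<^sub>M b\<in>B. (lborel :: real measure)) (restrict_space borel U)
           (\<lambda>f. \<Sum>b\<in>B. f b *\<^sub>R b))"

definition subspace_lebesgue :: "'a::euclidean_space set \<Rightarrow> 'a measure" where
  "subspace_lebesgue U = completion (subspace_lborel U)"

text \<open>
  The \<open>m\<close>-dimensional measure of \<open>A\<close> within the subspace \<open>U\<close>; \<^const>\<open>dim\<close> is the real dimension.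
  Only \<open>m \<ge> dim U\<close> is meaningful; the value for \<open>m < dim U\<close> is a dummy.
\<close>

definition subspace_volume :: "nat \<Rightarrow> 'a::euclidean_space set \<Rightarrow> 'a set \<Rightarrow> ennreal" where
  "subspace_volume m U A = (if m = dim U then emeasure (subspace_lebesgue U) A else 0)"


section \<open>Orthogonal bases, coordinate subspaces and orthogonal projections\<close>

definition orthogonal_basis :: "nat \<Rightarrow> (nat \<Rightarrow> 'a::euclidean_space) \<Rightarrow> bool" where
  "orthogonal_basis n v \<longleftrightarrow>
     inj_on v {1..n} \<and> independent (v ` {1..n}) \<and> span (v ` {1..n}) = UNIV \<and>
     (\<forall>i\<in>{1..n}. \<forall>j\<in>{1..n}. i \<noteq> j \<longrightarrow> inner (v i) (v j) = 0)"

definition corthogonal_basis :: "nat \<Rightarrow> (nat \<Rightarrow> 'a::complex_euclidean_space) \<Rightarrow> bool" where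
  "corthogonal_basis n v \<longleftrightarrow>
     inj_on v {1..n} \<and> complex_vector.independent (v ` {1..n}) \<and>
     complex_vector.span (v ` {1..n}) = UNIV \<and>
     (\<forall>i\<in>{1..n}. \<forall>j\<in>{1..n}. i \<noteq> j \<longrightarrow> cinner (v i) (v j) = 0)"

text \<open>
  A multi-index \<open>1 \<le> i\<^sub>1 < \<dots> < i\<^sub>q \<le> n\<close> is represented by the set of its entries.
\<close>

definition multi_indices :: "nat \<Rightarrow> nat \<Rightarrow> nat set set" where
  "multi_indices q n = {I. I \<subseteq> {1..n} \<and> card I = q}"

definition coord_subspace :: "(nat \<Rightarrow> 'a::euclidean_space) \<Rightarrow> nat set \<Rightarrow> 'a set" where
  "coord_subspace v I = span (v ` I)"

definition ccoord_subspace :: "(nat \<Rightarrow> 'a::complex_euclidean_space) \<Rightarrow> nat set \<Rightarrow> 'a set" where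
  "ccoord_subspace v I = complex_vector.span (v ` I)"

definition orth_proj :: "'a::euclidean_space set \<Rightarrow> 'a \<Rightarrow> 'a" where
  "orth_proj W x = (THE w. w \<in> W \<and> (\<forall>u\<in>W. inner u (x - w) = 0))"

definition corth_proj :: "'a::complex_euclidean_space set \<Rightarrow> 'a \<Rightarrow> 'a" where
  "corth_proj W x = (THE w. w \<in> W \<and> (\<forall>u\<in>W. cinner u (x - w) = 0))"

end

theory Submission
  imports Defs
begin

text \<open>
  Normalise the given basis to an orthonormal basis \<open>e\<^sub>1, \<dots>, e\<^sub>n\<close>, and for a set \<open>I\<close> of indices let
  \<open>P\<^sub>I\<close> be the orthogonal projection on the coordinate subspace of \<open>I\<close>. No determinants are needed:
  the projections are compared with each other by removing one index at a time.

  Let \<open>W = P\<^sub>I V\<close>, let \<open>i \<in> I\<close>, and let \<open>u\<close> be the orthogonal projection of \<open>e\<^sub>i\<close> on \<open>W\<close>. On \<open>W\<close> the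
  projection along \<open>e\<^sub>i\<close> is the identity except in the direction of \<open>u\<close>, which it shortens by
  the factor \<open>sqrt (1 - \<parallel>u\<parallel>\<^sup>2)\<close> while keeping it orthogonal to the other directions. Hence
  \<open>D I = |P\<^sub>I S|\<^sup>2\<close> satisfies \<open>D (I - {i}) = (1 - \<parallel>u\<parallel>\<^sup>2) D I\<close>, in the degenerate case
  \<open>\<parallel>u\<parallel> = 1\<close> as well, since then the dimension drops (lemma \<open>subspace_volume_step\<close>).
  If \<open>dim W = p\<close>, the squared norms \<open>\<parallel>u\<parallel>\<^sup>2\<close> for \<open>i \<in> I\<close> add up to the trace \<open>p\<close> of the projection on
  \<open>W\<close> (lemma \<open>sum_orth_proj_norms\<close>), so that \<open>\<Sum>i\<in>I. D (I - {i})\<close> is \<open>(card I - p) D I\<close>; if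
  \<open>dim W < p\<close>, both sides vanish. Summing over all \<open>I\<close> with \<open>q + 1\<close> elements and
  counting twice relates the sums for \<open>q\<close> and \<open>q + 1\<close>, and the binomial coefficient
  results by descending from \<open>q = n\<close>, where the only projection is the identity (lemma \<open>sum_multi_indices_downward\<close>).

  In the complex case the complex direction of \<open>e\<^sub>i\<close> is removed by removing the real directions \<open>e\<^sub>i\<close> and
  \<open>\<i> e\<^sub>i\<close> one after the other. Each contributes the factor \<open>sqrt (1 - \<parallel>u\<parallel>\<^sup>2)\<close>, so the same
  recursion holds for \<open>D I = |P\<^sub>I S|\<close> without the square
  (lemma \<open>subspace_volume_step_complex\<close>), with \<open>p\<close> now the complex dimension.

  On the side of measure theory, one needs that the measure on a subspace does not depend on the
  orthonormal basis (lemma \<open>frame_measure_unique\<close>). This is reduced to the rotation invariance of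
  Lebesgue measure on the whole space by completing the basis and taking products with a unit cube
  in the orthogonal complement; rotation invariance follows from Vitali's covering theorem because
  rotations map balls to balls of the same radius.
\<close>

section \<open>Rotation invariance of Lebesgue measure\<close>

lemma emeasure_lborel_ball_center:
  fixes a :: "'a::euclidean_space"
  shows "emeasure lborel (ball a r) = emeasure lborel (ball (0::'a) r)"
proof -
  have "emeasure lborel (ball a r) = emeasure (distr lborel borel ((+) a)) (ball a r)"
    by (simp add: lborel_distr_plus)
  also have "\<dots> = emeasure lborel ((+) a -` ball a r)"
    by (subst emeasure_distr) simp_all
  also have "(+) a -` ball a r = ball 0 r"
    by (auto simp: dist_norm)
  finally show ?thesis .
qed

text \<open>
  By Vitali's theorem an open set is, up to a null set, a countable disjoint union of balls.
  An orthogonal map permutes the balls of each radius, and it is Lipschitz, so it preserves null sets.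
\<close>
lemma emeasure_lborel_orthogonal_vimage_open:
  fixes T :: "'a::euclidean_space \<Rightarrow> 'a"
  assumes T: "orthogonal_transformation T" and U: "open U"
  shows "emeasure lborel (T -` U) = emeasure lborel U"
proof -
  define G where "G = inv T"
  have bij: "bij T" using T by (rule orthogonal_transformation_bij)
  have G: "orthogonal_transformation G"
    unfolding G_def using T by (rule orthogonal_transformation_inv)
  have vim: "T -` X = G ` X" for X
    unfolding G_def using bij by (simp add: bij_vimage_eq_inv_image)
  have contT: "continuous_on UNIV T"
    using T by (intro linear_continuous_on linear_conv_bounded_linear[THEN iffD1]
        orthogonal_transformation_linear)
  have [measurable]: "T \<in> borel_measurable borel"
    using contT by (rule borel_measurable_continuous_onI)
  define K where "K = {(x, r). ball x r \<subseteq> U \<and> 0 < (r::real)}"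
  have cover: "\<exists>i. i \<in> K \<and> x \<in> ball (fst i) (snd i) \<and> snd i < d" if x: "x \<in> U" and d: "0 < d" for x d
  proof -
    obtain e where e: "e > 0" "ball x e \<subseteq> U" using U x open_contains_ball by blast
    have "(x, min e (d / 2)) \<in> K" using e d by (auto simp: K_def)
    moreover have "x \<in> ball x (min e (d / 2))" "min e (d / 2) < d" using e d by auto
    ultimately show ?thesis by (intro exI[of _ "(x, min e (d / 2))"]) auto
  qed
  obtain C where C: "countable C" "C \<subseteq> K"
    and dj: "pairwise (\<lambda>i j. disjnt (ball (fst i) (snd i)) (ball (fst j) (snd j))) C"
    and neg: "negligible (U - (\<Union>i\<in>C. ball (fst i) (snd i)))"
    by (rule Vitali_covering_theorem_balls[of U K fst snd]) (use cover in blast)+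
  define W where "W = (\<Union>i\<in>C. ball (fst i) (snd i))"
  have WU: "W \<subseteq> U" using C by (fastforce simp: W_def K_def)
  have Wo: "open W" by (auto simp: W_def)
  have null: "emeasure lborel N = 0" if "negligible N" "N \<in> sets borel" for N :: "'a set"
    using that by (simp add: negligible_iff_emeasure0)
  have UN: "emeasure lborel U = emeasure lborel W"
  proof -
    have "emeasure lborel (U - W) = 0" using neg Wo U by (intro null) (auto simp: W_def)
    then show ?thesis
      using emeasure_Un_null_set[of W lborel "U - W"] WU U Wo
      by (simp add: Un_Diff_cancel null_sets_def Un_absorb1)
  qed
  have VN: "emeasure lborel (T -` U) = emeasure lborel (T -` W)"
  proof -
    have "negligible (T -` (U - W))"
      unfolding vim using neg G
      by (intro negligible_differentiable_image_negligible)
         (auto simp: W_def intro: linear_imp_differentiable_on orthogonal_transformation_linear)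
    moreover have "T -` (U - W) \<in> sets borel"
      using measurable_sets[of T borel borel "U - W"] U Wo by simp
    ultimately have "emeasure lborel (T -` (U - W)) = 0" by (rule null)
    moreover have "T -` W \<in> sets borel" "T -` U \<in> sets borel"
      using measurable_sets[of T borel borel] U Wo by auto
    ultimately show ?thesis
      using emeasure_Un_null_set[of "T -` W" lborel "T -` (U - W)"] WU
        \<open>T -` (U - W) \<in> sets borel\<close>
      by (simp add: null_sets_def vimage_Un[symmetric] Un_Diff_cancel Un_absorb1)
  qed
  have balls: "T -` ball a r = ball (G a) r" for a r
    unfolding vim using G by (rule image_orthogonal_transformation_ball)
  have disj: "disjoint_family_on (\<lambda>i. ball (fst i) (snd i)) C"
    using dj by (auto simp: disjoint_family_on_def pairwise_def disjnt_def)
  then have disj': "disjoint_family_on (\<lambda>i. T -` ball (fst i) (snd i)) C"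
    by (fastforce simp: disjoint_family_on_def)
  have "emeasure lborel (T -` W) = (\<integral>\<^sup>+i. emeasure lborel (T -` ball (fst i) (snd i)) \<partial>count_space C)"
    unfolding W_def vimage_UN using C disj' by (intro emeasure_UN_countable) (auto simp: balls)
  also have "\<dots> = (\<integral>\<^sup>+i. emeasure lborel (ball (fst i) (snd i)) \<partial>count_space C)"
    unfolding balls by (intro nn_integral_cong)
      (metis emeasure_lborel_ball_center)
  also have "\<dots> = emeasure lborel W"
    unfolding W_def using C disj by (intro emeasure_UN_countable[symmetric]) auto
  finally show ?thesis using UN VN by simp
qed

lemma lborel_distr_orthogonal:
  fixes T :: "'a::euclidean_space \<Rightarrow> 'a"
  assumes T: "orthogonal_transformation T"
  shows "distr lborel borel T = lborel"
proof (rule measure_eqI_generator_eq)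
  have contT: "continuous_on UNIV T"
    using T by (intro linear_continuous_on linear_conv_bounded_linear[THEN iffD1]
        orthogonal_transformation_linear)
  have [measurable]: "T \<in> borel_measurable borel"
    using contT by (rule borel_measurable_continuous_onI)
  have eq: "emeasure (distr lborel borel T) X = emeasure lborel X" if "open X" for X
    using that emeasure_lborel_orthogonal_vimage_open[OF T that]
    by (subst emeasure_distr) auto
  show "Int_stable {S::'a set. open S}" by (auto simp: Int_stable_def)
  show "{S::'a set. open S} \<subseteq> Pow UNIV" by simp
  show "sets (distr lborel borel T) = sigma_sets UNIV {S. open S}"
    by (simp add: sets_borel)
  show "sets (lborel :: 'a measure) = sigma_sets UNIV {S. open S}"
    by (simp add: sets_borel)
  show "emeasure (distr lborel borel T) X = emeasure lborel X" if "X \<in> {S. open S}" for X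
    using that eq by simp
  show "range (\<lambda>n. ball 0 (real n)) \<subseteq> {S::'a set. open S}" by auto
  show "(\<Union>n. ball (0::'a) (real n)) = UNIV"
    by (auto intro: reals_Archimedean2)
  show "emeasure (distr lborel borel T) (ball 0 (real i)) \<noteq> \<infinity>" for i
    using emeasure_lborel_ball_finite[of "0::'a" "real i"] by (simp add: eq)
qed

section \<open>Lebesgue measure in orthonormal coordinates\<close>

text \<open>
  Renaming the coordinates along \<open>p\<close> and dividing the one indexed by \<open>b\<close> by \<open>s b\<close> pushes the product
  of Lebesgue measures forward to its multiple by the product of the \<open>s b\<close>.
\<close>
lemma PiM_lborel_rescale:
  fixes s :: "'i \<Rightarrow> real" and p :: "'i \<Rightarrow> 'j"
  assumes fin: "finite B" and inj: "inj_on p B" and s: "\<And>b. b \<in> B \<Longrightarrow> 0 < s b"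
  shows "(\<Pi>\<^sub>M b\<in>B. (lborel :: real measure)) =
    scale_measure (ennreal (inverse (\<Prod>b\<in>B. s b)))
      (distr (\<Pi>\<^sub>M c\<in>p ` B. (lborel :: real measure)) (\<Pi>\<^sub>M b\<in>B. lborel)
        (\<lambda>g. \<lambda>b\<in>B. g (p b) / s b))"
    (is "_ = scale_measure ?k (distr ?P ?Q ?T)")
proof -
  interpret product_sigma_finite "\<lambda>_. lborel :: real measure" ..
  have P2: "product_sigma_finite (\<lambda>_::'j. lborel :: real measure)" ..
  have [measurable]: "?T \<in> ?P \<rightarrow>\<^sub>M ?Q"
    by (intro measurable_restrict) simp
  show ?thesis
  proof (rule PiM_eqI[symmetric])
    fix A :: "'i \<Rightarrow> real set" assume A: "\<And>i. i \<in> B \<Longrightarrow> A i \<in> sets lborel"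
    define q where "q = inv_into B p"
    have q: "q (p b) = b" if "b \<in> B" for b using that inj by (simp add: q_def)
    have "emeasure (distr ?P ?Q ?T) (Pi\<^sub>E B A) = emeasure ?P (?T -` Pi\<^sub>E B A \<inter> space ?P)"
      using A fin by (intro emeasure_distr) (auto intro!: sets_PiM_I_finite)
    also have "?T -` Pi\<^sub>E B A \<inter> space ?P = (\<Pi>\<^sub>E c\<in>p ` B. {y. y / s (q c) \<in> A (q c)})"
      by (auto simp: space_PiM PiE_iff extensional_def q)
    also have "emeasure ?P \<dots> = (\<Prod>c\<in>p ` B. emeasure lborel {y. y / s (q c) \<in> A (q c)})"
    proof (rule product_sigma_finite.emeasure_PiM[OF P2])
      show "finite (p ` B)" using fin by simp
    next
      fix c assume "c \<in> p ` B"
      then have "A (q c) \<in> sets borel" using A q by auto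
      then have [measurable]: "A (q c) \<in> sets borel" .
      show "{y. y / s (q c) \<in> A (q c)} \<in> sets lborel" by measurable
    qed
    also have "\<dots> = (\<Prod>b\<in>B. emeasure lborel {y. y / s b \<in> A b})"
      using inj by (subst prod.reindex) (auto simp: q intro!: prod.cong)
    also have "\<dots> = (\<Prod>b\<in>B. ennreal (s b) * emeasure lborel (A b))"
    proof (rule prod.cong[OF refl])
      fix b assume b: "b \<in> B"
      have [measurable]: "A b \<in> sets borel" using A b by simp
      have "emeasure lborel {y. y / s b \<in> A b} = emeasure (distr lborel borel ((*) (inverse (s b)))) (A b)"
        by (subst emeasure_distr) (auto simp: vimage_def field_simps)
      also have "\<dots> = emeasure (density lborel (\<lambda>_. ennreal (s b))) (A b)"
        using s[OF b] by (subst lborel_distr_mult) auto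
      also have "\<dots> = ennreal (s b) * emeasure lborel (A b)"
        by (subst emeasure_density_const) auto
      finally show "emeasure lborel {y. y / s b \<in> A b} = ennreal (s b) * emeasure lborel (A b)" .
    qed
    also have "\<dots> = ennreal (\<Prod>b\<in>B. s b) * (\<Prod>b\<in>B. emeasure lborel (A b))"
      using s by (simp add: prod.distrib prod_ennreal less_imp_le)
    finally have "emeasure (distr ?P ?Q ?T) (Pi\<^sub>E B A) = \<dots>" .
    moreover have "0 < (\<Prod>b\<in>B. s b)" using s by (rule prod_pos)
    ultimately show "emeasure (scale_measure ?k (distr ?P ?Q ?T)) (Pi\<^sub>E B A) = (\<Prod>b\<in>B. emeasure lborel (A b))"
      by (simp add: mult.assoc[symmetric] ennreal_mult[symmetric])
  qed (use fin in auto)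
qed

text \<open>The vector with coordinates \<open>f\<close> with respect to \<open>B\<close>; values of \<open>f\<close> outside \<open>B\<close> play no role.\<close>
definition frame_sum :: "'a::euclidean_space set \<Rightarrow> ('a \<Rightarrow> real) \<Rightarrow> 'a" where
  "frame_sum B f = (\<Sum>b\<in>B. f b *\<^sub>R b)"

text \<open>
  The product of the Lebesgue measures of the coordinates with respect to \<open>B\<close>, as a Borel measure on
  the whole space. For an orthonormal basis \<open>B\<close> of a subspace \<open>V\<close> it is concentrated on \<open>V\<close>.
\<close>
definition frame_measure :: "'a::euclidean_space set \<Rightarrow> 'a measure" where
  "frame_measure B = distr (\<Pi>\<^sub>M b\<in>B. (lborel :: real measure)) borel (frame_sum B)"

lemma orthonormal_basis_ofD:
  fixes V :: "'a::euclidean_space set"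
  assumes "orthonormal_basis_of V B"
  shows "finite B" "independent B" "card B = dim V" "B \<subseteq> V" "subspace V" "span B = V"
    and "\<And>b c. b \<in> B \<Longrightarrow> c \<in> B \<Longrightarrow> inner b c = (if b = c then 1 else 0)"
proof -
  have B: "pairwise orthogonal B" "\<And>b. b \<in> B \<Longrightarrow> norm b = 1" "span B = V"
    using assms by (auto simp: orthonormal_basis_of_def)
  have "0 \<notin> B" using B(2) by fastforce
  with B(1) show ind: "independent B" by (rule pairwise_orthogonal_independent)
  then show "finite B" by (rule independent_imp_finite)
  show "card B = dim V" using ind B(3) by (metis dim_span_eq_card_independent)
  show "B \<subseteq> V" using B(3) span_superset by blast
  show "subspace V" using B(3) subspace_span by blast
  show "span B = V" by fact
  show "inner b c = (if b = c then 1 else 0)" if "b \<in> B" "c \<in> B" for b c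
    using B(1) B(2)[OF that(1)] that by (auto simp: pairwise_def orthogonal_def norm_eq_1)
qed

lemma orthonormal_basis_exists:
  fixes V :: "'a::euclidean_space set"
  assumes "subspace V"
  obtains B where "orthonormal_basis_of V B"
proof -
  obtain B where "pairwise orthogonal B" "\<And>b. b \<in> B \<Longrightarrow> norm b = 1" "span B = V"
    using orthonormal_basis_subspace[OF assms] by blast
  then show ?thesis by (intro that[of B]) (auto simp: orthonormal_basis_of_def)
qed

lemma frame_sum_inner:
  assumes "orthonormal_basis_of V B" "b \<in> B"
  shows "inner (frame_sum B f) b = f b"
proof -
  have "inner (frame_sum B f) b = (\<Sum>c\<in>B. f c * (if c = b then 1 else 0))"
    unfolding frame_sum_def inner_sum_left inner_scaleR_left
    using orthonormal_basis_ofD(7)[OF assms(1) _ assms(2)] by (intro sum.cong) auto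
  then show ?thesis
    using orthonormal_basis_ofD(1)[OF assms(1)] assms(2) by (simp add: if_distrib cong: if_cong)
qed

lemma frame_sum_expand:
  assumes B: "orthonormal_basis_of V B" and x: "x \<in> V"
  shows "frame_sum B (inner x) = x"
proof -
  note D = orthonormal_basis_ofD[OF B]
  have mem: "frame_sum B (inner x) \<in> span B"
    unfolding frame_sum_def by (intro span_sum span_scale span_base)
  have orth: "orthogonal (x - frame_sum B (inner x)) b" if "b \<in> B" for b
    using frame_sum_inner[OF B that] by (simp add: orthogonal_def inner_diff_left)
  have "x - frame_sum B (inner x) \<in> span B"
    using mem x D(5,6) by (simp add: subspace_diff)
  then have "orthogonal (x - frame_sum B (inner x)) (x - frame_sum B (inner x))"
    using orth by (rule orthogonal_to_span)
  then show ?thesis by (simp add: orthogonal_def)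
qed

lemma frame_sum_norm:
  assumes B: "orthonormal_basis_of V B"
  shows "(norm (frame_sum B f))\<^sup>2 = (\<Sum>b\<in>B. (f b)\<^sup>2)"
proof -
  have "(norm (frame_sum B f))\<^sup>2 = inner (frame_sum B f) (\<Sum>b\<in>B. f b *\<^sub>R b)"
    by (simp add: power2_norm_eq_inner frame_sum_def)
  also have "\<dots> = (\<Sum>b\<in>B. (f b)\<^sup>2)"
    by (simp add: inner_sum_right frame_sum_inner[OF B] power2_eq_square cong: sum.cong)
  finally show ?thesis .
qed

lemma frame_sum_in:
  assumes B: "orthonormal_basis_of V B"
  shows "frame_sum B f \<in> V"
proof -
  have "frame_sum B f \<in> span B"
    unfolding frame_sum_def by (intro span_sum span_scale span_base)
  then show ?thesis using orthonormal_basis_ofD(6)[OF B] by simp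
qed

lemma frame_sum_measurable [measurable]:
  "frame_sum B \<in> (\<Pi>\<^sub>M b\<in>B. (lborel :: real measure)) \<rightarrow>\<^sub>M borel"
  unfolding frame_sum_def[abs_def]
  by (intro borel_measurable_sum borel_measurable_scaleR) (auto intro: measurable_component_singleton)

text \<open>
  A bijection from the standard basis onto \<open>B\<close> induces an orthogonal map, and Lebesgue measure is
  invariant under it.
\<close>
lemma frame_measure_UNIV:
  fixes B :: "'a::euclidean_space set"
  assumes B: "orthonormal_basis_of UNIV B"
  shows "frame_measure B = lborel"
proof -
  note D = orthonormal_basis_ofD[OF B]
  have Bas: "orthonormal_basis_of UNIV (Basis :: 'a set)"
    by (auto simp: orthonormal_basis_of_def pairwise_def orthogonal_def inner_Basis)
  obtain p where p: "bij_betw p (Basis :: 'a set) B"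
    using D(1,3) by (metis finite_Basis bij_betw_iff_card dim_UNIV)
  define R where "R x = (\<Sum>b\<in>Basis. inner x b *\<^sub>R p b)" for x :: 'a
  have lin: "linear R"
    unfolding R_def by (auto intro!: linearI simp: inner_add_left scaleR_add_left sum.distrib scaleR_sum_right)
  have Rf: "R x = frame_sum B (\<lambda>c. inner x (inv_into Basis p c))" for x
    unfolding R_def frame_sum_def sum.reindex_bij_betw[OF p, symmetric]
    using p by (intro sum.cong) (auto simp: bij_betw_def)
  have "(norm (R x))\<^sup>2 = (norm x)\<^sup>2" for x
  proof -
    have "(norm (R x))\<^sup>2 = (\<Sum>b\<in>Basis. (inner x b)\<^sup>2)"
      unfolding Rf frame_sum_norm[OF B] sum.reindex_bij_betw[OF p, symmetric]
      using p by (intro sum.cong) (auto simp: bij_betw_def)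
    also have "\<dots> = (norm (frame_sum Basis (inner x)))\<^sup>2"
      by (simp add: frame_sum_norm[OF Bas])
    finally show ?thesis by (simp add: frame_sum_expand[OF Bas])
  qed
  then have R: "orthogonal_transformation R"
    using lin by (auto simp: orthogonal_transformation)
  have R_meas [measurable]: "R \<in> borel \<rightarrow>\<^sub>M borel"
    using lin by (intro borel_measurable_continuous_onI linear_continuous_on)
      (simp add: linear_conv_bounded_linear)
  let ?P = "\<Pi>\<^sub>M b\<in>Basis :: 'a set. (lborel :: real measure)"
  let ?Q = "\<Pi>\<^sub>M b\<in>B. (lborel :: real measure)"
  let ?T = "\<lambda>g::'a \<Rightarrow> real. \<lambda>b\<in>Basis. g (p b)"
  have pB: "p ` Basis = B" and inj: "inj_on p Basis" using p by (auto simp: bij_betw_def)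
  have T [measurable]: "?T \<in> ?Q \<rightarrow>\<^sub>M ?P"
    using pB by (intro measurable_restrict) (auto intro!: measurable_component_singleton)
  have PQ: "?P = distr ?Q ?P ?T"
  proof -
    have "scale_measure 1 M = M" for M :: "('a \<Rightarrow> real) measure"
      by (intro measure_eqI) auto
    then show ?thesis
      using PiM_lborel_rescale[OF finite_Basis inj, of "\<lambda>_. 1"] by (simp add: pB)
  qed
  have lb: "(lborel :: 'a measure) = distr ?P borel (frame_sum Basis)"
    unfolding frame_sum_def[abs_def] by (rule lborel_eq)
  have "lborel = distr lborel borel R" by (simp add: lborel_distr_orthogonal[OF R])
  also have "\<dots> = distr (distr ?P borel (frame_sum Basis)) borel R"
    unfolding lb[symmetric] ..
  also have "\<dots> = distr ?P borel (\<lambda>f. R (frame_sum Basis f))"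
    using distr_distr[OF R_meas frame_sum_measurable[of "Basis :: 'a set"]] by (simp add: o_def)
  also have "\<dots> = distr (distr ?Q ?P ?T) borel (\<lambda>f. R (frame_sum Basis f))"
    by (subst PQ[symmetric]) (rule refl)
  also have "\<dots> = distr ?Q borel (\<lambda>g. R (frame_sum Basis (?T g)))"
    using distr_distr[OF measurable_compose[OF frame_sum_measurable R_meas] T] by (simp add: o_def)
  also have "\<dots> = distr ?Q borel (frame_sum B)"
  proof (rule distr_cong)
    fix g :: "'a \<Rightarrow> real"
    have "R (frame_sum Basis (?T g)) = (\<Sum>b\<in>Basis. g (p b) *\<^sub>R p b)"
      unfolding R_def by (intro sum.cong) (auto simp: frame_sum_inner[OF Bas])
    then show "R (frame_sum Basis (?T g)) = frame_sum B g"
      unfolding frame_sum_def sum.reindex_bij_betw[OF p, symmetric] by simp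
  qed auto
  finally show ?thesis by (simp add: frame_measure_def)
qed

text \<open>
  With \<open>C\<close> an orthonormal basis of the orthogonal complement of \<open>V\<close>, the measure of \<open>A\<close> is the
  full-dimensional volume of the product of \<open>A \<inter> V\<close> with the unit cube spanned by \<open>C\<close>. The right-hand
  side does not mention \<open>B\<close>, which gives independence of the basis.
\<close>
lemma frame_measure_slab:
  fixes V :: "'a::euclidean_space set"
  assumes B: "orthonormal_basis_of V B" and C: "orthonormal_basis_of {x. \<forall>y\<in>V. orthogonal y x} C"
    and A [measurable]: "A \<in> sets borel"
  shows "emeasure (frame_measure B) A =
    emeasure lborel {x. x - frame_sum C (inner x) \<in> A \<and> (\<forall>c\<in>C. inner x c \<in> {0..1})}"
proof -
  note DB = orthonormal_basis_ofD[OF B] and DC = orthonormal_basis_ofD[OF C]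
  have orth: "inner b c = 0" if "b \<in> B" "c \<in> C" for b c
    using that DB(4) DC(4) by (auto simp: orthogonal_def)
  have disj: "B \<inter> C = {}"
    using orth DB(7) by fastforce
  have BC: "orthonormal_basis_of UNIV (B \<union> C)"
  proof -
    have "x \<in> span (B \<union> C)" for x
    proof -
      obtain y z where yz: "y \<in> span V" "\<And>w. w \<in> span V \<Longrightarrow> orthogonal z w" "x = y + z"
        using orthogonal_subspace_decomp_exists[of V x] by metis
      have "y \<in> span B" using yz(1) DB(5,6) by (metis span_eq_iff)
      moreover have "z \<in> span C"
        unfolding DC(6) using yz(2) by (auto simp: orthogonal_commute span_base)
      ultimately show ?thesis unfolding yz(3)
        by (meson span_add span_mono subsetD sup_ge1 sup_ge2)
    qed
    moreover have "pairwise orthogonal (B \<union> C)"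
      unfolding pairwise_def orthogonal_def
      using DB(7) DC(7) orth by (metis Un_iff inner_commute)
    ultimately show ?thesis
      using B C by (auto simp: orthonormal_basis_of_def)
  qed
  let ?P = "\<Pi>\<^sub>M b\<in>B. (lborel :: real measure)"
  let ?Q = "\<Pi>\<^sub>M b\<in>C. (lborel :: real measure)"
  let ?PQ = "\<Pi>\<^sub>M b\<in>B \<union> C. (lborel :: real measure)"
  interpret product_sigma_finite "\<lambda>_::'a. lborel :: real measure" ..
  interpret Q: finite_product_sigma_finite "\<lambda>_::'a. lborel :: real measure" C
    by standard (rule DC(1))
  let ?X = "{x. x - frame_sum C (inner x) \<in> A \<and> (\<forall>c\<in>C. inner x c \<in> {0..1})}"
  have fC [measurable]: "(\<lambda>x. frame_sum C (inner x)) \<in> borel \<rightarrow>\<^sub>M borel"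
    unfolding frame_sum_def by measurable
  have X [measurable]: "?X \<in> sets borel"
  proof -
    have 1: "(\<lambda>x. x - frame_sum C (inner x)) -` A \<in> sets borel"
      using measurable_sets[of "\<lambda>x. x - frame_sum C (inner x)" borel borel A] by simp
    have "{x. inner x c \<in> {0..1}} \<in> sets borel" for c :: 'a by measurable
    then have 2: "{x \<in> space borel. \<forall>c\<in>C. inner x c \<in> {0..1}} \<in> sets borel"
      using DC(1) by (intro sets.sets_Collect_finite_All) auto
    have eq: "?X = (\<lambda>x. x - frame_sum C (inner x)) -` A \<inter> {x \<in> space borel. \<forall>c\<in>C. inner x c \<in> {0..1}}"
      by auto
    show ?thesis unfolding eq using 1 2 by (rule sets.Int)
  qed
  have dm: "distr (?P \<Otimes>\<^sub>M ?Q) ?PQ (merge B C) = ?PQ"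
    using disj DB(1) DC(1) by (rule distr_merge)
  have "emeasure lborel ?X = emeasure (frame_measure (B \<union> C)) ?X"
    by (simp add: frame_measure_UNIV[OF BC])
  also have "\<dots> = emeasure ?PQ (frame_sum (B \<union> C) -` ?X \<inter> space ?PQ)"
    unfolding frame_measure_def by (rule emeasure_distr[OF frame_sum_measurable X])
  also have "\<dots> = emeasure (distr (?P \<Otimes>\<^sub>M ?Q) ?PQ (merge B C)) (frame_sum (B \<union> C) -` ?X \<inter> space ?PQ)"
    by (simp only: dm)
  also have "\<dots> = emeasure (?P \<Otimes>\<^sub>M ?Q)
      (merge B C -` (frame_sum (B \<union> C) -` ?X \<inter> space ?PQ) \<inter> space (?P \<Otimes>\<^sub>M ?Q))"
    using measurable_sets[OF frame_sum_measurable X] by (intro emeasure_distr measurable_merge)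
  also have "merge B C -` (frame_sum (B \<union> C) -` ?X \<inter> space ?PQ) \<inter> space (?P \<Otimes>\<^sub>M ?Q) =
      (frame_sum B -` A \<inter> space ?P) \<times> (\<Pi>\<^sub>E c\<in>C. {0..1})"
  proof -
    have 1: "frame_sum (B \<union> C) (merge B C (f, g)) = frame_sum B f + frame_sum C g" for f g
      unfolding frame_sum_def using DB(1) DC(1) disj
      by (subst sum.union_disjoint) (auto simp: merge_def intro!: arg_cong2[of _ _ _ _ "(+)"] sum.cong)
    have 2: "inner (frame_sum B f + frame_sum C g) c = g c" if "c \<in> C" for f g c
    proof -
      have "inner (frame_sum B f) c = 0"
        using that orth by (simp add: frame_sum_def inner_sum_left)
      then show ?thesis using that by (simp add: inner_add_left frame_sum_inner[OF C])
    qed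
    have 3: "frame_sum C (inner (frame_sum B f + frame_sum C g)) = frame_sum C g" for f g
      unfolding frame_sum_def[of C "inner _"] by (subst sum.cong[OF refl, of C _ "\<lambda>c. g c *\<^sub>R c"])
        (use 2 in \<open>auto simp: frame_sum_def\<close>)
    show ?thesis
      by (auto simp: space_pair_measure space_PiM 1 2 3 PiE_iff)
  qed
  also have "emeasure (?P \<Otimes>\<^sub>M ?Q) \<dots> =
      emeasure ?P (frame_sum B -` A \<inter> space ?P) * emeasure ?Q (\<Pi>\<^sub>E c\<in>C. {0..1})"
    using measurable_sets[OF frame_sum_measurable A] DC(1)
    by (intro Q.emeasure_pair_measure_Times sets_PiM_I_finite) simp_all
  also have "emeasure ?Q (\<Pi>\<^sub>E c\<in>C. {0..1}) = 1"
    using emeasure_PiM[OF DC(1), of "\<lambda>_. {0..1}"] by simp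
  also have "emeasure ?P (frame_sum B -` A \<inter> space ?P) = emeasure (frame_measure B) A"
    unfolding frame_measure_def by (rule emeasure_distr[OF frame_sum_measurable A, symmetric])
  finally show ?thesis by simp
qed

lemma frame_measure_unique:
  fixes V :: "'a::euclidean_space set"
  assumes B: "orthonormal_basis_of V B" and B': "orthonormal_basis_of V B'"
  shows "frame_measure B = frame_measure B'"
proof (rule measure_eqI)
  show "sets (frame_measure B) = sets (frame_measure B')" by (simp add: frame_measure_def)
  fix A assume "A \<in> sets (frame_measure B)"
  then have A: "A \<in> sets borel" by (simp add: frame_measure_def)
  have "subspace {x. \<forall>y\<in>V. orthogonal y x}"
    by (auto simp: subspace_def orthogonal_def inner_add_right)
  then obtain C where C: "orthonormal_basis_of {x. \<forall>y\<in>V. orthogonal y x} C"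
    by (rule orthonormal_basis_exists)
  show "emeasure (frame_measure B) A = emeasure (frame_measure B') A"
    unfolding frame_measure_slab[OF B C A] frame_measure_slab[OF B' C A] ..
qed

lemma subspace_borel:
  fixes V :: "'a::euclidean_space set"
  assumes "subspace V" shows "V \<in> sets borel"
  using closed_subspace[OF assms] by (rule borel_closed)

lemma sets_subspace_lborel:
  "sets (subspace_lborel V) = sets (restrict_space borel V)"
  by (simp add: subspace_lborel_def Let_def)

lemma sets_subspace_lborel_iff:
  assumes "subspace V"
  shows "A \<in> sets (subspace_lborel V) \<longleftrightarrow> A \<in> sets borel \<and> A \<subseteq> V"
  using subspace_borel[OF assms] by (auto simp: sets_subspace_lborel sets_restrict_space_iff)

lemma emeasure_subspace_lborel:
  fixes V :: "'a::euclidean_space set"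
  assumes B: "orthonormal_basis_of V B" and A: "A \<in> sets (subspace_lborel V)"
  shows "emeasure (subspace_lborel V) A = emeasure (frame_measure B) A"
proof -
  define B' where "B' = (SOME B. orthonormal_basis_of V B)"
  have B': "orthonormal_basis_of V B'" unfolding B'_def using B by (rule someI)
  let ?P = "\<Pi>\<^sub>M b\<in>B'. (lborel :: real measure)"
  have A': "A \<in> sets borel" "A \<subseteq> V"
    using A sets_subspace_lborel_iff[OF orthonormal_basis_ofD(5)[OF B]] by auto
  have "frame_sum B' \<in> ?P \<rightarrow>\<^sub>M restrict_space borel V"
    using frame_sum_in[OF B'] by (intro measurable_restrict_space2) auto
  then have "emeasure (subspace_lborel V) A = emeasure ?P (frame_sum B' -` A \<inter> space ?P)"
    using A unfolding subspace_lborel_def Let_def B'_def[symmetric] frame_sum_def[abs_def]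
    by (subst emeasure_distr) simp_all
  also have "\<dots> = emeasure (frame_measure B') A"
    unfolding frame_measure_def using A' by (subst emeasure_distr) auto
  finally show ?thesis using frame_measure_unique[OF B B'] by simp
qed

text \<open>
  If \<open>L\<close> maps the orthonormal basis \<open>B\<close> of \<open>V\<close> to the vectors \<open>s b *\<^sub>R p b\<close>, where the \<open>p b\<close> form an
  orthonormal basis of \<open>W\<close>, then \<open>L\<close> multiplies volumes by the product of the \<open>s b\<close>. The measurability of
  the image is part of the claim.
\<close>
lemma subspace_lborel_scaling:
  fixes V W :: "'a::euclidean_space set"
  assumes B: "orthonormal_basis_of V B" and C: "orthonormal_basis_of W (p ` B)"
    and inj: "inj_on p B" and s: "\<And>b. b \<in> B \<Longrightarrow> 0 < s b"
    and lin: "linear L" and L: "\<And>b. b \<in> B \<Longrightarrow> L b = s b *\<^sub>R p b"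
    and A: "A \<in> sets (subspace_lborel V)"
  shows "L ` A \<in> sets (subspace_lborel W) \<and>
    emeasure (subspace_lborel W) (L ` A) = ennreal (\<Prod>b\<in>B. s b) * emeasure (subspace_lborel V) A"
proof -
  note DB = orthonormal_basis_ofD[OF B] and DC = orthonormal_basis_ofD[OF C]
  have A': "A \<in> sets borel" "A \<subseteq> V"
    using A sets_subspace_lborel_iff[OF DB(5)] by auto
  note [measurable] = A'(1)
  \<comment> \<open>\<open>G\<close> restricts to the inverse of \<open>L\<close> on \<open>W\<close>, so that images under \<open>L\<close> are preimages under \<open>G\<close>.\<close>
  define G where "G y = (\<Sum>b\<in>B. (inner y (p b) / s b) *\<^sub>R b)" for y :: 'a
  have [measurable]: "G \<in> borel \<rightarrow>\<^sub>M borel" unfolding G_def by measurable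
  have snz: "s b \<noteq> 0" if "b \<in> B" for b using s[OF that] by simp
  have Lsum: "L (\<Sum>b\<in>B. f b *\<^sub>R b) = (\<Sum>b\<in>B. (f b * s b) *\<^sub>R p b)" for f
    using L by (simp add: linear_sum[OF lin] linear_scale[OF lin] cong: sum.cong)
  have Csum: "frame_sum (p ` B) g = (\<Sum>b\<in>B. g (p b) *\<^sub>R p b)" for g
    unfolding frame_sum_def using inj by (simp add: sum.reindex)
  have GC: "G (frame_sum (p ` B) g) = (\<Sum>b\<in>B. (g (p b) / s b) *\<^sub>R b)" for g
    unfolding G_def using frame_sum_inner[OF C, of _ g] by (intro sum.cong) auto
  have LG: "L (G y) = y" if "y \<in> W" for y
  proof -
    have "L (G y) = (\<Sum>b\<in>B. inner y (p b) *\<^sub>R p b)"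
      unfolding G_def Lsum using snz by (intro sum.cong) auto
    then show ?thesis using frame_sum_expand[OF C that] Csum by metis
  qed
  have LV: "L x = frame_sum (p ` B) (\<lambda>c. inner x (inv_into B p c) * s (inv_into B p c))" if "x \<in> V" for x
  proof -
    have "L x = L (\<Sum>b\<in>B. inner x b *\<^sub>R b)"
      using frame_sum_expand[OF B that] by (simp add: frame_sum_def)
    then show ?thesis unfolding Lsum Csum using inj by simp
  qed
  have GL: "G (L x) = x" if "x \<in> V" for x
  proof -
    have "G (L x) = (\<Sum>b\<in>B. inner x b *\<^sub>R b)"
      unfolding LV[OF that] GC using snz inj by (intro sum.cong) auto
    then show ?thesis using frame_sum_expand[OF B that] by (simp add: frame_sum_def)
  qed
  have LW: "L x \<in> W" if "x \<in> V" for x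
    unfolding LV[OF that] by (rule frame_sum_in[OF C])
  have img: "L ` A = {y. y \<in> W \<and> G y \<in> A}"
    using A'(2) GL LG LW by (force simp: image_iff)
  have W [measurable]: "W \<in> sets borel" using DC(5) by (rule subspace_borel)
  have imgm: "L ` A \<in> sets borel" unfolding img by measurable
  have imgs: "L ` A \<in> sets (subspace_lborel W)"
    unfolding sets_subspace_lborel_iff[OF DC(5)] using imgm img by auto
  let ?P = "\<Pi>\<^sub>M b\<in>B. (lborel :: real measure)"
  let ?Q = "\<Pi>\<^sub>M b\<in>p ` B. (lborel :: real measure)"
  let ?T = "\<lambda>g::'a \<Rightarrow> real. \<lambda>b\<in>B. g (p b) / s b"
  have T: "?T \<in> ?Q \<rightarrow>\<^sub>M ?P" by (intro measurable_restrict) simp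
  have pre: "?T -` (frame_sum B -` A \<inter> space ?P) \<inter> space ?Q = frame_sum (p ` B) -` (L ` A) \<inter> space ?Q"
  proof -
    have "frame_sum B (?T g) = G (frame_sum (p ` B) g)" for g
      unfolding GC unfolding frame_sum_def by (intro sum.cong) auto
    then show ?thesis
      unfolding img using frame_sum_in[OF C] by (auto simp: space_PiM)
  qed
  define k where "k = (\<Prod>b\<in>B. s b)"
  have k: "0 < k" unfolding k_def using s by (rule prod_pos)
  have "emeasure (subspace_lborel V) A = emeasure ?P (frame_sum B -` A \<inter> space ?P)"
    unfolding emeasure_subspace_lborel[OF B A] frame_measure_def
    by (subst emeasure_distr) auto
  also have "\<dots> = ennreal (inverse k) * emeasure (distr ?Q ?P ?T) (frame_sum B -` A \<inter> space ?P)"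
    by (subst PiM_lborel_rescale[OF DB(1) inj s]) (auto simp: k_def)
  also have "emeasure (distr ?Q ?P ?T) (frame_sum B -` A \<inter> space ?P) =
      emeasure ?Q (frame_sum (p ` B) -` (L ` A) \<inter> space ?Q)"
    unfolding pre[symmetric] using T
    by (intro emeasure_distr) (auto intro: measurable_sets)
  also have "\<dots> = emeasure (subspace_lborel W) (L ` A)"
    unfolding emeasure_subspace_lborel[OF C imgs] frame_measure_def using imgm
    by (subst emeasure_distr) auto
  finally have "ennreal k * emeasure (subspace_lborel V) A =
      ennreal k * (ennreal (inverse k) * emeasure (subspace_lborel W) (L ` A))" by simp
  also have "\<dots> = emeasure (subspace_lborel W) (L ` A)"
    using k by (simp add: mult.assoc[symmetric] ennreal_mult[symmetric])
  finally show ?thesis using imgs by (simp add: k_def)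
qed

text \<open>Passing to the completion: \<open>L\<close> maps subsets of null sets to subsets of null sets.\<close>
lemma subspace_lebesgue_scaling:
  fixes V W :: "'a::euclidean_space set"
  assumes B: "orthonormal_basis_of V B" and C: "orthonormal_basis_of W (p ` B)"
    and inj: "inj_on p B" and s: "\<And>b. b \<in> B \<Longrightarrow> 0 < s b"
    and lin: "linear L" and L: "\<And>b. b \<in> B \<Longrightarrow> L b = s b *\<^sub>R p b"
    and S: "S \<in> sets (subspace_lebesgue V)"
  shows "L ` S \<in> sets (subspace_lebesgue W)"
    and "emeasure (subspace_lebesgue W) (L ` S) = ennreal (\<Prod>b\<in>B. s b) * emeasure (subspace_lebesgue V) S"
proof -
  obtain A N N' where S': "S = A \<union> N" "N \<subseteq> N'" "N' \<in> null_sets (subspace_lborel V)" "A \<in> sets (subspace_lborel V)"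
    using S unfolding subspace_lebesgue_def by (rule sets_completionE)
  note scal = subspace_lborel_scaling[OF B C inj s lin L]
  have null: "L ` N' \<in> null_sets (subspace_lborel W)"
    using scal[of N'] S'(3) by (auto simp: null_sets_def)
  have LA: "L ` A \<in> sets (subspace_lborel W)" using scal[of A] S'(4) by blast
  have LS: "L ` S = L ` A \<union> L ` N" "L ` N \<subseteq> L ` N'" using S' by auto
  have nN: "N \<in> null_sets (completion (subspace_lborel V))"
    using S' by (auto simp: null_sets_completion_iff2)
  have nLN: "L ` N \<in> null_sets (completion (subspace_lborel W))"
    using null LS(2) by (auto simp: null_sets_completion_iff2)
  show "L ` S \<in> sets (subspace_lebesgue W)"
    unfolding subspace_lebesgue_def using LS null LA by (rule sets_completionI)
  have "emeasure (subspace_lebesgue W) (L ` S) = emeasure (subspace_lborel W) (L ` A)"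
    unfolding subspace_lebesgue_def LS(1) using LA nLN by (simp add: emeasure_Un_null_set)
  also have "\<dots> = ennreal (\<Prod>b\<in>B. s b) * emeasure (subspace_lborel V) A"
    using scal[of A] S'(4) by blast
  also have "emeasure (subspace_lborel V) A = emeasure (subspace_lebesgue V) S"
    unfolding subspace_lebesgue_def S'(1) using S'(4) nN by (simp add: emeasure_Un_null_set)
  finally show "emeasure (subspace_lebesgue W) (L ` S) = ennreal (\<Prod>b\<in>B. s b) * emeasure (subspace_lebesgue V) S" .
qed

section \<open>Volume under removal of one direction\<close>

text \<open>
  The basic step. The map \<open>L\<close> projects along a unit vector \<open>e\<close>, and \<open>u\<close> is the orthogonal projection of
  \<open>e\<close> on \<open>W\<close>. On \<open>W \<inter> e\<^sup>\<bottom>\<close> the map \<open>L\<close> is the identity; the direction of \<open>u\<close>, orthogonal to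
  it in \<open>W\<close>, is mapped to a direction still orthogonal to it and is shortened by the factor
  \<open>sqrt (1 - \<parallel>u\<parallel>\<^sup>2)\<close>. If \<open>dim W < m\<close>, both volumes vanish.
\<close>
lemma subspace_volume_step:
  fixes W :: "'a::euclidean_space set"
  assumes W: "subspace W" and dimW: "dim W \<le> m"
    and meas: "dim W = m \<Longrightarrow> S \<in> sets (subspace_lebesgue W)"
    and e: "norm e = 1" and u: "u \<in> W" and orth: "\<And>x. x \<in> W \<Longrightarrow> inner x (e - u) = 0"
    and L: "\<And>x. L x = x - inner x e *\<^sub>R e"
  shows "subspace_volume m (L ` W) (L ` S) = ennreal (sqrt (1 - (norm u)\<^sup>2)) * subspace_volume m W S"
    and "dim (L ` W) = m \<Longrightarrow> L ` S \<in> sets (subspace_lebesgue (L ` W))"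
    and "(norm u)\<^sup>2 \<le> 1"
proof -
  have lin: "linear L"
    unfolding L by (auto intro!: linearI simp: inner_add_left algebra_simps)
  have xe: "inner x e = inner x u" if "x \<in> W" for x
    using orth[OF that] by (simp add: inner_diff_right)
  have ue: "inner u e = (norm u)\<^sup>2"
    using xe[OF u] by (simp add: power2_norm_eq_inner)
  have ee: "inner e e = 1" using e by (simp add: norm_eq_1)
  have pyth: "(norm (e - u))\<^sup>2 = 1 - (norm u)\<^sup>2"
    unfolding power2_norm_eq_inner[of "e - u"]
    using ue ee by (simp add: inner_diff_left inner_diff_right inner_commute power2_norm_eq_inner)
  show le1: "(norm u)\<^sup>2 \<le> 1" using pyth zero_le_power2[of "norm (e - u)"] by linarith
  have dim_le: "dim (L ` W) \<le> dim W" using lin by (rule dim_image_le)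
  have "subspace_volume m (L ` W) (L ` S) = ennreal (sqrt (1 - (norm u)\<^sup>2)) * subspace_volume m W S \<and>
    (dim (L ` W) = m \<longrightarrow> L ` S \<in> sets (subspace_lebesgue (L ` W)))"
  proof (cases "dim W = m")
    case False
    then show ?thesis using dim_le dimW by (auto simp: subspace_volume_def)
  next
    case True
    note S = meas[OF True]
    have SW: "S \<subseteq> W"
      using sets.sets_into_space[OF S]
      by (simp add: subspace_lebesgue_def subspace_lborel_def Let_def space_restrict_space)
    consider (one) "(norm u)\<^sup>2 = 1" | (zero) "u = 0" | (mid) "u \<noteq> 0" "(norm u)\<^sup>2 < 1"
      using le1 by fastforce
    \<comment> \<open>If \<open>\<parallel>u\<parallel> = 1\<close> then \<open>e \<in> W\<close> and the dimension drops; if \<open>u = 0\<close> then \<open>L\<close> is the identity on \<open>W\<close>.\<close>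
    then show ?thesis
    proof cases
      case one
      then have eu: "e = u" using pyth by simp
      have "L ` W \<subseteq> W" using u W eu by (auto simp: L intro: subspace_diff subspace_scale)
      moreover have "inner y e = 0" if "y \<in> L ` W" for y
        using that ee by (auto simp: L inner_diff_left)
      then have "e \<notin> L ` W" using ee by auto
      ultimately have "L ` W \<subset> W" using u eu by auto
      then have "span (L ` W) \<subset> span W"
        using W lin by (metis linear_subspace_image span_eq_iff)
      then have "dim (L ` W) < dim W" by (rule dim_psubset)
      then show ?thesis using True one by (auto simp: subspace_volume_def)
    next
      case zero
      have "L x = x" if "x \<in> W" for x using xe[OF that] zero by (simp add: L)
      then have "L ` W = W" "L ` S = S" using SW by (auto simp: image_iff subset_iff)
      then show ?thesis using zero S by simp
    next
      case mid
      \<comment> \<open>An orthonormal basis of \<open>W\<close> adapted to \<open>e\<close>: the unit vector \<open>w\<close> along \<open>u\<close>, and a basis of \<open>W \<inter> e\<^sup>\<bottom>\<close>.\<close>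
      define w where "w = u /\<^sub>R norm u"
      define W1 where "W1 = {x \<in> W. inner x e = 0}"
      have w: "w \<in> W" "norm w = 1" using mid u W by (auto simp: w_def intro: subspace_scale)
      have we: "inner w e = norm u"
        using ue mid by (simp add: w_def power2_eq_square)
      have "subspace W1"
        using W by (auto simp: W1_def subspace_def inner_add_left)
      then obtain B1 where B1: "orthonormal_basis_of W1 B1" by (rule orthonormal_basis_exists)
      note D1 = orthonormal_basis_ofD[OF B1]
      have B1w: "inner b w = 0" "inner b e = 0" "b \<in> W" if "b \<in> B1" for b
        using that D1(4) xe by (auto simp: W1_def w_def)
      have B1n: "norm b = 1" if "b \<in> B1" for b
        using B1 that by (auto simp: orthonormal_basis_of_def)
      have wB1: "w \<notin> B1" using B1w(1) w(2) by (metis norm_eq_1 zero_neq_one)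
      define B where "B = insert w B1"
      have B: "orthonormal_basis_of W B"
      proof -
        have "pairwise orthogonal B" unfolding B_def
          using B1 B1w(1) by (auto simp: orthonormal_basis_of_def pairwise_insert orthogonal_def inner_commute)
        moreover have "x \<in> span B" if "x \<in> W" for x
        proof -
          have "inner x w * norm u = inner x e"
            using xe[OF that] mid(1) by (simp add: w_def)
          then have "inner (x - inner x w *\<^sub>R w) e = 0"
            by (simp add: inner_diff_left we)
          then have "x - inner x w *\<^sub>R w \<in> W1"
            using that w(1) W by (simp add: W1_def subspace_diff subspace_scale)
          then have "x - inner x w *\<^sub>R w \<in> span B"
            using D1(6) span_mono[of B1 B] by (auto simp: B_def)
          moreover have "inner x w *\<^sub>R w \<in> span B" by (auto simp: B_def intro: span_scale span_base)
          ultimately show ?thesis using span_add by fastforce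
        qed
        moreover have "span B \<subseteq> W"
          using W w(1) B1w(3) by (intro span_minimal) (auto simp: B_def)
        ultimately show ?thesis
          using B1n w(2) by (auto simp: orthonormal_basis_of_def B_def)
      qed
      define t where "t = sqrt (1 - (norm u)\<^sup>2)"
      have t: "0 < t" using mid by (simp add: t_def)
      have Lw: "norm (L w) = t"
      proof -
        have "(norm (L w))\<^sup>2 = inner w w - (inner w e)\<^sup>2"
          unfolding power2_norm_eq_inner
          by (simp add: L inner_diff_left inner_diff_right ee inner_commute power2_eq_square)
        also have "\<dots> = 1 - (norm u)\<^sup>2" using w(2) we by (simp add: norm_eq_1)
        finally show ?thesis unfolding t_def by (metis norm_ge_zero real_sqrt_unique)
      qed
      define p where "p b = (if b = w then L w /\<^sub>R t else b)" for b
      define s where "s b = (if b = w then t else 1)" for b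
      have LB1: "L b = b" if "b \<in> B1" for b using B1w(2)[OF that] by (simp add: L)
      have Lb: "L b = s b *\<^sub>R p b" if "b \<in> B" for b
        using that t LB1 by (auto simp: B_def s_def p_def)
      have pB: "p ` B = insert (L w /\<^sub>R t) B1"
        using wB1 by (auto simp: B_def p_def)
      have orthp: "inner b (L w /\<^sub>R t) = 0" if "b \<in> B1" for b
        using B1w[OF that] by (simp add: L inner_diff_right)
      have normp: "norm (L w /\<^sub>R t) = 1" using Lw t by simp
      have notin: "L w /\<^sub>R t \<notin> B1"
        using orthp normp by (metis norm_eq_1 zero_neq_one)
      have inj: "inj_on p B"
        using wB1 notin by (auto simp: inj_on_def B_def p_def)
      have LW: "L ` W = span (p ` B)"
      proof -
        have "L ` W = span (L ` B)"
          using orthonormal_basis_ofD(6)[OF B] linear_span_image[OF lin, of B] by simp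
        also have "L ` B = insert (L w) B1" using LB1 by (auto simp: B_def)
        also have "span \<dots> = span (insert (L w /\<^sub>R t) B1)"
        proof (rule span_eq[THEN iffD2], intro conjI subsetI)
          fix x assume "x \<in> insert (L w) B1"
          moreover have "L w = t *\<^sub>R (L w /\<^sub>R t)" using t by simp
          then have "L w \<in> span (insert (L w /\<^sub>R t) B1)"
            by (metis insertI1 span_base span_scale)
          ultimately show "x \<in> span (insert (L w /\<^sub>R t) B1)" by (auto intro: span_base)
        next
          fix x assume "x \<in> insert (L w /\<^sub>R t) B1"
          then show "x \<in> span (insert (L w) B1)" by (auto intro: span_base span_scale)
        qed
        finally show ?thesis by (simp add: pB)
      qed
      have C: "orthonormal_basis_of (L ` W) (p ` B)"
        unfolding orthonormal_basis_of_def LW pB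
        using B1 B1n normp orthp
        by (auto simp: orthonormal_basis_of_def pairwise_insert orthogonal_def inner_commute)
      have spos: "0 < s b" for b using t by (simp add: s_def)
      have prod: "(\<Prod>b\<in>B. s b) = t"
        using D1(1) wB1 by (simp add: B_def s_def prod.neutral)
      note scal = subspace_lebesgue_scaling[OF B C inj spos lin Lb S]
      have "dim (L ` W) = dim W"
        using orthonormal_basis_ofD(3)[OF C] orthonormal_basis_ofD(3)[OF B] inj by (simp add: card_image)
      then show ?thesis
        using scal True by (simp add: subspace_volume_def prod t_def)
    qed
  qed
  then show "subspace_volume m (L ` W) (L ` S) = ennreal (sqrt (1 - (norm u)\<^sup>2)) * subspace_volume m W S"
    and "dim (L ` W) = m \<Longrightarrow> L ` S \<in> sets (subspace_lebesgue (L ` W))" by auto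
qed

section \<open>Summation over multi-indices\<close>

lemma finite_multi_indices: "finite (multi_indices q n)"
  by (rule finite_subset[of _ "Pow {1..n}"]) (auto simp: multi_indices_def)

text \<open>
  Double counting: a set \<open>J\<close> of \<open>q\<close> indices arises from \<open>n - q\<close> sets of \<open>Suc q\<close> indices by removing one.
\<close>
lemma sum_multi_indices_remove:
  fixes D :: "nat set \<Rightarrow> ennreal"
  assumes "q < n"
  shows "(\<Sum>I\<in>multi_indices (Suc q) n. \<Sum>i\<in>I. D (I - {i})) = of_nat (n - q) * (\<Sum>J\<in>multi_indices q n. D J)"
proof -
  have fin: "finite I" if "I \<in> multi_indices k n" for I k
    using that finite_subset by (fastforce simp: multi_indices_def)
  have "(\<Sum>I\<in>multi_indices (Suc q) n. \<Sum>i\<in>I. D (I - {i})) =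
      (\<Sum>(I, i)\<in>(SIGMA I:multi_indices (Suc q) n. I). D (I - {i}))"
    using fin finite_multi_indices by (subst sum.Sigma) auto
  also have "\<dots> = (\<Sum>(J, i)\<in>(SIGMA J:multi_indices q n. {1..n} - J). D J)"
    by (rule sum.reindex_bij_witness[where i = "\<lambda>(J, i). (insert i J, i)" and j = "\<lambda>(I, i). (I - {i}, i)"])
       (auto simp: multi_indices_def card_insert_if insert_absorb finite_subset[of _ "{1..n}"])
  also have "\<dots> = (\<Sum>J\<in>multi_indices q n. \<Sum>i\<in>{1..n} - J. D J)"
    using finite_multi_indices by (subst sum.Sigma) auto
  also have "\<dots> = (\<Sum>J\<in>multi_indices q n. of_nat (n - q) * D J)"
    by (intro sum.cong refl) (auto simp: multi_indices_def card_Diff_subset finite_subset[of _ "{1..n}"])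
  finally show ?thesis by (simp add: sum_distrib_left)
qed

text \<open>
  The recursion passes from \<open>q = n\<close>, where the sum has the single term \<open>D {1..n}\<close>, down to smaller
  \<open>q\<close>: one has \<open>(n - q) * \<Sigma>\<^sub>q = (q + 1 - p) * \<Sigma>\<^sub>q\<^sub>+\<^sub>1\<close> for the sums \<open>\<Sigma>\<^sub>q\<close> of \<open>D\<close> over the multi-indices of
  length \<open>q\<close>, which the binomial coefficients solve.
\<close>
lemma sum_multi_indices_downward:
  fixes D :: "nat set \<Rightarrow> ennreal"
  assumes step: "\<And>I. I \<subseteq> {1..n} \<Longrightarrow> p < card I \<Longrightarrow> (\<Sum>i\<in>I. D (I - {i})) = of_nat (card I - p) * D I"
    and pq: "p \<le> q" and qn: "q \<le> n"
  shows "(\<Sum>I\<in>multi_indices q n. D I) = of_nat ((n - p) choose (n - q)) * D {1..n}"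
  using qn pq
proof (induction rule: inc_induct)
  case base
  have "multi_indices n n = {{1..n}}"
    using card_subset_eq[of "{1..n}"] by (auto simp: multi_indices_def)
  then show ?case by simp
next
  case (step q)
  define k where "k = n - Suc q"
  have k: "n - q = Suc k" "n - Suc q = k" "(n - p) - k = Suc q - p" using step.hyps step.prems by (auto simp: k_def)
  have binom: "Suc k * ((n - p) choose Suc k) = (Suc q - p) * ((n - p) choose k)"
    using binomial_absorption[of k "n - p"] binomial_absorb_comp[of "n - p" k] k(3) by simp
  have "of_nat (Suc k) * (\<Sum>I\<in>multi_indices q n. D I) =
      (\<Sum>I\<in>multi_indices (Suc q) n. \<Sum>i\<in>I. D (I - {i}))"
    using sum_multi_indices_remove[of q n D] step.hyps k by simp
  also have "\<dots> = (\<Sum>I\<in>multi_indices (Suc q) n. of_nat (Suc q - p) * D I)"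
    using step.prems assms(1) by (intro sum.cong refl) (auto simp: multi_indices_def)
  also have "\<dots> = of_nat (Suc q - p) * (of_nat ((n - p) choose k) * D {1..n})"
    using step.IH step.prems k by (simp add: sum_distrib_left[symmetric])
  also have "\<dots> = of_nat (Suc k) * (of_nat ((n - p) choose Suc k) * D {1..n})"
    unfolding mult.assoc[symmetric] of_nat_mult[symmetric] binom ..
  finally show ?case
    unfolding k(1) by (subst (asm) ennreal_mult_cancel_left) (auto simp: ennreal_of_nat_eq_real_of_nat)
qed

lemma ennreal_inverse_of_nat_cancel:
  assumes "0 < k"
  shows "inverse (of_nat k) * (of_nat k * x) = (x :: ennreal)"
  using assms by (simp add: mult.assoc[symmetric] ennreal_of_nat_eq_real_of_nat inverse_ennreal ennreal_mult[symmetric])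

lemma remove_induct:
  assumes "finite A" and I: "I \<subseteq> A" and top: "Q A"
    and step: "\<And>I i. I \<subseteq> A \<Longrightarrow> i \<in> I \<Longrightarrow> Q I \<Longrightarrow> Q (I - {i})"
  shows "Q I"
proof -
  have "Q (A - K)" if "finite K" "K \<subseteq> A" for K
    using that
  proof (induction rule: finite_induct)
    case empty
    then show ?case using top by simp
  next
    case (insert i K)
    then have "Q (A - K - {i})" by (intro step) auto
    then show ?case by (metis Diff_insert)
  qed
  from this[of "A - I"] show ?thesis
    using assms(1) I by (simp add: double_diff)
qed

text \<open>
  The recursion of \<open>sum_multi_indices_downward\<close> holds if removing \<open>i\<close> from \<open>I\<close> multiplies \<open>D\<close> by \<open>1 - a i\<close>, where the
  weights add up to \<open>p\<close> unless \<open>D I = 0\<close>.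
\<close>
lemma sum_remove_weights:
  fixes D :: "nat set \<Rightarrow> ennreal"
  assumes D: "\<And>i. i \<in> I \<Longrightarrow> D (I - {i}) = ennreal (1 - a i) * D I" "\<And>i. i \<in> I \<Longrightarrow> a i \<le> 1"
    and a: "D I = 0 \<or> (\<Sum>i\<in>I. a i) = real p" and p: "p \<le> card I"
  shows "(\<Sum>i\<in>I. D (I - {i})) = of_nat (card I - p) * D I"
proof (cases "D I = 0")
  case True
  then show ?thesis using D(1) by simp
next
  case False
  have "(\<Sum>i\<in>I. D (I - {i})) = (\<Sum>i\<in>I. ennreal (1 - a i)) * D I"
    using D(1) by (simp add: sum_distrib_right)
  also have "(\<Sum>i\<in>I. ennreal (1 - a i)) = ennreal (\<Sum>i\<in>I. 1 - a i)"
    using D(2) by (intro sum_ennreal) simp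
  also have "(\<Sum>i\<in>I. 1 - a i) = real (card I - p)"
    using False a p by (simp add: sum_subtractf of_nat_diff)
  finally show ?thesis by (simp add: ennreal_of_nat_eq_real_of_nat)
qed

section \<open>Orthogonal projections on coordinate subspaces\<close>

lemma orth_proj_eqI:
  fixes W :: "'a::euclidean_space set"
  assumes W: "subspace W" and w: "w \<in> W" "\<And>u. u \<in> W \<Longrightarrow> inner u (x - w) = 0"
  shows "orth_proj W x = w"
  unfolding orth_proj_def
proof (rule the_equality)
  show "w \<in> W \<and> (\<forall>u\<in>W. inner u (x - w) = 0)" using w by simp
next
  fix w' assume w': "w' \<in> W \<and> (\<forall>u\<in>W. inner u (x - w') = 0)"
  then have "w' - w \<in> W" using w(1) W by (simp add: subspace_diff)
  then have "inner (w' - w) (x - w) - inner (w' - w) (x - w') = 0" using w w' by simp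
  then have "inner (w' - w) (w' - w) = 0" by (simp add: inner_diff_right)
  then show "w' = w" by simp
qed

lemma orth_proj_frame_sum:
  fixes W :: "'a::euclidean_space set"
  assumes B: "orthonormal_basis_of W B"
  shows "orth_proj W x = frame_sum B (inner x)"
proof (rule orth_proj_eqI)
  show "subspace W" using B by (rule orthonormal_basis_ofD)
  show "frame_sum B (inner x) \<in> W" by (rule frame_sum_in[OF B])
  show "inner y (x - frame_sum B (inner x)) = 0" if "y \<in> W" for y
  proof -
    have "inner (frame_sum B (inner y)) (x - frame_sum B (inner x)) =
        (\<Sum>b\<in>B. inner y b * (inner b x - inner b (frame_sum B (inner x))))"
      unfolding frame_sum_def[of B "inner y"] by (simp add: inner_sum_left inner_diff_right sum_subtractf right_diff_distrib)
    also have "\<dots> = 0"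
      using frame_sum_inner[OF B, of _ "inner x"] by (intro sum.neutral) (simp add: inner_commute)
    finally show ?thesis by (simp add: frame_sum_expand[OF B that])
  qed
qed

lemma orth_proj_props:
  fixes W :: "'a::euclidean_space set"
  assumes W: "subspace W"
  shows "orth_proj W x \<in> W" and "y \<in> W \<Longrightarrow> inner y (x - orth_proj W x) = 0"
proof -
  obtain B where B: "orthonormal_basis_of W B" using W by (rule orthonormal_basis_exists)
  show "orth_proj W x \<in> W" unfolding orth_proj_frame_sum[OF B] by (rule frame_sum_in[OF B])
  obtain w z where wz: "w \<in> span W" "\<And>v. v \<in> span W \<Longrightarrow> orthogonal z v" "x = w + z"
    using orthogonal_subspace_decomp_exists[of W x] by metis
  have "orth_proj W x = w"
    using W wz span_base[of _ W] by (intro orth_proj_eqI) (auto simp: orthogonal_def inner_commute span_eq_iff[THEN iffD2, OF W])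
  then show "inner y (x - orth_proj W x) = 0" if "y \<in> W"
    using wz span_base[OF that] by (simp add: orthogonal_def inner_commute)
qed

lemma orth_proj_UNIV: "orth_proj UNIV x = x"
  by (rule orth_proj_eqI) auto

text \<open>
  The sum of the components of \<open>x\<close> along the vectors \<open>e i\<close> with \<open>i \<in> I\<close>; for an orthonormal family it is
  the orthogonal projection on their span.
\<close>
definition coord_proj :: "('i \<Rightarrow> 'a::euclidean_space) \<Rightarrow> 'i set \<Rightarrow> 'a \<Rightarrow> 'a" where
  "coord_proj e I x = (\<Sum>i\<in>I. inner x (e i) *\<^sub>R e i)"

lemma linear_coord_proj: "linear (coord_proj e I)"
  unfolding coord_proj_def
  by (auto intro!: linearI simp: inner_add_left scaleR_add_left sum.distrib scaleR_sum_right)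

lemma coord_proj_inner:
  assumes "finite I" "i \<in> I" "\<And>j. j \<in> I \<Longrightarrow> inner (e j) (e i) = (if j = i then 1 else 0)"
  shows "inner (coord_proj e I x) (e i) = inner x (e i)"
proof -
  have "inner (coord_proj e I x) (e i) = (\<Sum>j\<in>I. if j = i then inner x (e i) else 0)"
    unfolding coord_proj_def inner_sum_left using assms(3) by (intro sum.cong) auto
  then show ?thesis using assms(1,2) by simp
qed

lemma coord_proj_remove:
  assumes "finite I" "i \<in> I" "\<And>j. j \<in> I \<Longrightarrow> inner (e j) (e i) = (if j = i then 1 else 0)"
  shows "coord_proj e (I - {i}) x = coord_proj e I x - inner (coord_proj e I x) (e i) *\<^sub>R e i"
  using coord_proj_inner[OF assms, of x] assms(1,2)
  by (simp add: coord_proj_def sum_diff1)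

lemma coord_proj_idem:
  assumes "finite I" "\<And>i j. i \<in> I \<Longrightarrow> j \<in> I \<Longrightarrow> inner (e i) (e j) = (if i = j then 1 else 0)"
  shows "coord_proj e I (coord_proj e I x) = coord_proj e I x"
proof -
  have "inner (coord_proj e I x) (e i) = inner x (e i)" if "i \<in> I" for i
    using assms(1) that by (rule coord_proj_inner) (use assms(2) that in blast)
  then show ?thesis unfolding coord_proj_def[of e I "coord_proj e I x"] by (simp add: coord_proj_def)
qed

text \<open>
  For an orthonormal family \<open>e\<close> the hypothesis says that \<open>W\<close> is contained in its span, and the left-hand side
  is the trace of the orthogonal projection on \<open>W\<close>. The proof expands both in an orthonormal basis \<open>B\<close>
  of \<open>W\<close> and exchanges the sums over \<open>I\<close> and \<open>B\<close>.
\<close>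
lemma sum_orth_proj_norms:
  fixes W :: "'a::euclidean_space set"
  assumes W: "subspace W" and fixed: "\<And>x. x \<in> W \<Longrightarrow> coord_proj e I x = x"
  shows "(\<Sum>i\<in>I. (norm (orth_proj W (e i)))\<^sup>2) = real (dim W)"
proof -
  obtain B where B: "orthonormal_basis_of W B" using W by (rule orthonormal_basis_exists)
  have "(\<Sum>i\<in>I. (norm (orth_proj W (e i)))\<^sup>2) = (\<Sum>i\<in>I. \<Sum>b\<in>B. (inner b (e i))\<^sup>2)"
    by (simp add: orth_proj_frame_sum[OF B] frame_sum_norm[OF B] inner_commute)
  also have "\<dots> = (\<Sum>b\<in>B. \<Sum>i\<in>I. (inner b (e i))\<^sup>2)" by (rule sum.swap)
  also have "\<dots> = (\<Sum>b\<in>B. 1)"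
  proof (rule sum.cong[OF refl])
    fix b assume b: "b \<in> B"
    then have bW: "b \<in> W" using orthonormal_basis_ofD(4)[OF B] by blast
    have "(\<Sum>i\<in>I. (inner b (e i))\<^sup>2) = inner b (coord_proj e I b)"
      by (simp add: coord_proj_def inner_sum_right power2_eq_square)
    then show "(\<Sum>i\<in>I. (inner b (e i))\<^sup>2) = 1"
      using fixed[OF bW] orthonormal_basis_ofD(7)[OF B b b] by simp
  qed
  also have "\<dots> = real (dim W)" using orthonormal_basis_ofD(3)[OF B] by simp
  finally show ?thesis .
qed

lemma orth_proj_coord_subspace:
  fixes v e :: "nat \<Rightarrow> 'a::euclidean_space"
  assumes I: "finite I"
    and e: "\<And>i j. i \<in> I \<Longrightarrow> j \<in> I \<Longrightarrow> inner (e i) (e j) = (if i = j then 1 else 0)"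
    and v: "\<And>i. i \<in> I \<Longrightarrow> v i = c i *\<^sub>R e i" "\<And>i. i \<in> I \<Longrightarrow> c i \<noteq> 0"
  shows "orth_proj (coord_subspace v I) x = coord_proj e I x"
proof (rule orth_proj_eqI)
  show "subspace (coord_subspace v I)" by (simp add: coord_subspace_def)
  have "e i \<in> span (v ` I)" if "i \<in> I" for i
  proof -
    have "e i = (1 / c i) *\<^sub>R v i" using v[OF that] by simp
    then show ?thesis using that by (metis image_eqI span_base span_scale)
  qed
  then show "coord_proj e I x \<in> coord_subspace v I"
    unfolding coord_proj_def coord_subspace_def by (intro span_sum span_scale)
  show "inner u (x - coord_proj e I x) = 0" if "u \<in> coord_subspace v I" for u
    using that unfolding coord_subspace_def
  proof (induction rule: span_induct_alt)
    case base
    show ?case by simp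
  next
    case (step k y z)
    then obtain i where i: "i \<in> I" "y = v i" by auto
    have "inner (v i) (x - coord_proj e I x) = 0"
      using coord_proj_inner[of I i e x] I e i(1) v(1)[OF i(1)]
      by (simp add: inner_diff_right inner_commute)
    then show ?case using step i by (simp add: inner_add_left)
  qed
qed

section \<open>The real case\<close>

lemma volume_square_eq_sum_projections:
  fixes V S :: "'a::euclidean_space set"
  assumes V: "subspace V" "dim V = p" and pq: "p \<le> q" and qn: "q \<le> n"
    and S: "S \<in> sets (subspace_lebesgue V)" and v: "orthogonal_basis n v"
  shows "(subspace_volume p V S)\<^sup>2 =
          inverse (of_nat ((n - p) choose (n - q))) *
          (\<Sum>I\<in>multi_indices q n.
             (subspace_volume p (orth_proj (coord_subspace v I) ` V)
                                (orth_proj (coord_subspace v I) ` S))\<^sup>2)"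
proof -
  define e where "e i = v i /\<^sub>R norm (v i)" for i
  have v0: "v i \<noteq> 0" if "i \<in> {1..n}" for i
    using v that dependent_zero[of "v ` {1..n}"] unfolding orthogonal_basis_def by (metis imageI)
  have vo: "inner (v i) (v j) = 0" if "i \<in> {1..n}" "j \<in> {1..n}" "i \<noteq> j" for i j
    using v that unfolding orthogonal_basis_def by blast
  have e: "inner (e i) (e j) = (if i = j then 1 else 0)" if "i \<in> {1..n}" "j \<in> {1..n}" for i j
  proof (cases "i = j")
    case True
    have "norm (e i) = 1" using v0[OF that(1)] by (simp add: e_def)
    then show ?thesis using True by (simp add: norm_eq_1)
  next
    case False
    then show ?thesis using vo[OF that] by (simp add: e_def)
  qed
  have ve: "v i = norm (v i) *\<^sub>R e i" "norm (v i) \<noteq> 0" if "i \<in> {1..n}" for i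
    using v0[OF that] by (auto simp: e_def)
  define P where "P = coord_proj e"
  have proj: "orth_proj (coord_subspace v I) = P I" if "I \<subseteq> {1..n}" for I
  proof
    fix x
    show "orth_proj (coord_subspace v I) x = P I x"
      unfolding P_def
    proof (rule orth_proj_coord_subspace[where c = "\<lambda>i. norm (v i)"])
      show "finite I" using that finite_subset by blast
    qed (use e ve that in blast)+
  qed
  have "coord_subspace v {1..n} = UNIV" using v by (simp add: orthogonal_basis_def coord_subspace_def)
  then have full: "P {1..n} = (\<lambda>x. x)"
    using proj[OF subset_refl, symmetric] by (simp add: orth_proj_UNIV fun_eq_iff)
  define D where "D I = (subspace_volume p (P I ` V) (P I ` S))\<^sup>2" for I
  define a where "a I i = (norm (orth_proj (P I ` V) (e i)))\<^sup>2" for I i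
  \<comment> \<open>Measurability of \<open>P I ` S\<close> is needed only while the dimension is still \<open>p\<close>:
      otherwise the volume is 0 by definition.\<close>
  define Q where "Q I \<longleftrightarrow> dim (P I ` V) = p \<longrightarrow> P I ` S \<in> sets (subspace_lebesgue (P I ` V))" for I
  have W: "subspace (P I ` V)" for I
    unfolding P_def using linear_coord_proj V(1) by (rule linear_subspace_image)
  have dW: "dim (P I ` V) \<le> p" for I
    unfolding P_def using dim_image_le[OF linear_coord_proj, of e I V] V(2) by simp
  have fin: "finite I" if "I \<subseteq> {1..n}" for I using that finite_subset by blast
  have step: "D (I - {i}) = ennreal (1 - a I i) * D I \<and> a I i \<le> 1 \<and> Q (I - {i})"
    if I: "I \<subseteq> {1..n}" "i \<in> I" "Q I" for I i
  proof -
    define L where "L x = x - inner x (e i) *\<^sub>R e i" for x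
    have "P (I - {i}) x = L (P I x)" for x
      unfolding L_def P_def using fin[OF I(1)] I(2)
      by (rule coord_proj_remove) (use e I(1,2) in blast)
    then have img: "P (I - {i}) ` X = L ` P I ` X" for X by (auto simp: image_iff)
    have meas: "P I ` S \<in> sets (subspace_lebesgue (P I ` V))" if "dim (P I ` V) = p"
      using I(3) that by (simp add: Q_def)
    have n1: "norm (e i) = 1" using e[of i i] I by (auto simp: norm_eq_1)
    note st = subspace_volume_step[OF W dW meas n1 orth_proj_props[OF W] L_def, folded a_def]
    have "(ennreal (sqrt (1 - a I i)))\<^sup>2 = ennreal (1 - a I i)"
      using st(3) by (simp add: power2_eq_square ennreal_mult[symmetric])
    then show ?thesis
      using st unfolding D_def Q_def img by (simp add: power_mult_distrib)
  qed
  have Q: "Q I" if "I \<subseteq> {1..n}" for I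
    using finite_atLeastAtMost that
  proof (rule remove_induct)
    show "Q {1..n}" unfolding Q_def full using S by simp
  qed (use step in blast)
  have rec: "(\<Sum>i\<in>I. D (I - {i})) = of_nat (card I - p) * D I" if I: "I \<subseteq> {1..n}" "p < card I" for I
  proof (rule sum_remove_weights)
    have "x \<in> P I ` V \<Longrightarrow> coord_proj e I x = x" for x
      unfolding P_def using coord_proj_idem[OF fin[OF I(1)], of e] e I(1) by blast
    then show "D I = 0 \<or> (\<Sum>i\<in>I. a I i) = real p"
      using sum_orth_proj_norms[OF W, of I e I] by (auto simp: a_def D_def subspace_volume_def)
  qed (use step Q I in auto)
  have "(\<Sum>I\<in>multi_indices q n. D I) = of_nat ((n - p) choose (n - q)) * D {1..n}"
    using rec pq qn by (rule sum_multi_indices_downward)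
  moreover have "D {1..n} = (subspace_volume p V S)\<^sup>2" unfolding D_def full by simp
  moreover have "(\<Sum>I\<in>multi_indices q n. D I) = (\<Sum>I\<in>multi_indices q n.
             (subspace_volume p (orth_proj (coord_subspace v I) ` V)
                                (orth_proj (coord_subspace v I) ` S))\<^sup>2)"
    by (intro sum.cong refl) (simp add: D_def proj multi_indices_def)
  moreover have "0 < (n - p) choose (n - q)" using pq qn by simp
  ultimately show ?thesis using ennreal_inverse_of_nat_cancel by metis
qed

section \<open>The complex case\<close>

lemma scaleC_eq_Re_Im: "c *\<^sub>C x = Re c *\<^sub>R x + Im c *\<^sub>R \<i> *\<^sub>C x"
proof -
  have "c *\<^sub>C x = (of_real (Re c) + of_real (Im c) * \<i>) *\<^sub>C x"
    by (simp add: complex_eq_iff)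
  then show ?thesis by (simp only: scaleC_add_left scaleC_of_real scaleC_scaleC[symmetric])
qed

lemma cinner_scaleC_right: "cinner x (c *\<^sub>C y) = c * cinner x y"
  by (metis cinner_commute cinner_scaleC_left complex_cnj_cnj complex_cnj_mult)

lemma inner_ii_left: "inner (\<i> *\<^sub>C x) y = Im (cinner x y)"
  by (simp add: Re_cinner[symmetric] cinner_scaleC_left)

lemma inner_ii_right: "inner x (\<i> *\<^sub>C y) = - Im (cinner x y)"
  by (simp add: Re_cinner[symmetric] cinner_scaleC_right)

lemma inner_ii_ii: "inner (\<i> *\<^sub>C x) (\<i> *\<^sub>C y) = inner x y"
  by (simp add: inner_ii_left cinner_scaleC_right Re_cinner)

lemma norm_ii: "norm (\<i> *\<^sub>C x) = norm x"
  by (simp add: norm_eq_sqrt_inner inner_ii_ii)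

lemma cinner_eq_inner: "cinner x y = Complex (inner x y) (inner (\<i> *\<^sub>C x) y)"
  by (simp add: complex_eq_iff Re_cinner inner_ii_left)

lemma inner_ii_self: "inner (\<i> *\<^sub>C x) x = 0"
proof -
  have "Im (cinner x x) = - Im (cinner x x)" by (subst cinner_commute) simp
  then show ?thesis by (simp add: inner_ii_left)
qed

lemma inner_ii_swap: "inner (\<i> *\<^sub>C x) y = - inner x (\<i> *\<^sub>C y)"
  by (simp add: inner_ii_left inner_ii_right)

lemma complex_subspace_imp_subspace:
  fixes V :: "'a::complex_euclidean_space set"
  assumes "complex_vector.subspace V" shows "subspace V"
  using assms unfolding subspace_def complex_vector.subspace_def by (metis scaleC_of_real)

text \<open>
  An inequality suffices: if the real dimension of \<open>V\<close> were smaller than \<open>2 * p\<close>, all volumes in question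
  would be 0 by definition.
\<close>
lemma dim_le_complex_dim:
  fixes V :: "'a::complex_euclidean_space set"
  shows "dim V \<le> 2 * complex_vector.dim V"
proof -
  obtain B where B: "B \<subseteq> V" "complex_vector.independent B" "V \<subseteq> complex_vector.span B"
      "card B = complex_vector.dim V"
    using complex_vector.basis_exists[of V] by metis
  have "span X \<subseteq> complex_vector.span X" for X :: "'a set"
    by (intro span_minimal complex_vector.span_superset complex_subspace_imp_subspace
        complex_vector.subspace_span)
  then have "independent B"
    using B(2) unfolding dependent_def complex_vector.dependent_def by blast
  then have fin: "finite B" by (rule independent_imp_finite)
  have "complex_vector.span B \<subseteq> span (B \<union> (\<lambda>x. \<i> *\<^sub>C x) ` B)"
  proof
    fix x assume "x \<in> complex_vector.span B"
    then show "x \<in> span (B \<union> (\<lambda>x. \<i> *\<^sub>C x) ` B)"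
    proof (induction rule: complex_vector.span_induct_alt)
      case base
      show ?case by (rule span_zero)
    next
      case (step c b y)
      have "c *\<^sub>C b \<in> span (B \<union> (\<lambda>x. \<i> *\<^sub>C x) ` B)"
        unfolding scaleC_eq_Re_Im[of c b] using step.hyps by (intro span_add span_scale span_base) auto
      then show ?case using step.IH by (rule span_add)
    qed
  qed
  then have "dim V \<le> card (B \<union> (\<lambda>x. \<i> *\<^sub>C x) ` B)"
    using B(3) fin by (intro dim_le_card) auto
  also have "\<dots> \<le> card B + card ((\<lambda>x. \<i> *\<^sub>C x) ` B)" by (rule card_Un_le)
  also have "\<dots> \<le> 2 * card B" using card_image_le[OF fin, of "\<lambda>x. \<i> *\<^sub>C x"] by simp
  finally show ?thesis using B(4) by simp
qed

lemma orth_proj_ii: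
  fixes W :: "'a::complex_euclidean_space set"
  assumes W: "subspace W" and Wi: "\<And>x. x \<in> W \<Longrightarrow> \<i> *\<^sub>C x \<in> W"
  shows "orth_proj W (\<i> *\<^sub>C x) = \<i> *\<^sub>C orth_proj W x"
proof (rule orth_proj_eqI[OF W])
  show "\<i> *\<^sub>C orth_proj W x \<in> W" using orth_proj_props(1)[OF W] by (rule Wi)
  show "inner y (\<i> *\<^sub>C x - \<i> *\<^sub>C orth_proj W x) = 0" if "y \<in> W" for y
    using orth_proj_props(2)[OF W Wi[OF that], of x]
    by (simp add: inner_diff_right inner_ii_swap)
qed

text \<open>
  Projecting along the complex line of \<open>e\<close> is projecting along the real directions \<open>e\<close> and \<open>\<i> *\<^sub>C e\<close> in
  turn. In the second step \<open>\<i> *\<^sub>C u\<close> still lies in \<open>L ` W\<close> and is the projection of \<open>\<i> *\<^sub>C e\<close> on it, so both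
  steps contribute the same factor \<open>sqrt (1 - \<parallel>u\<parallel>\<^sup>2)\<close>.
\<close>
lemma subspace_volume_step_complex:
  fixes W :: "'a::complex_euclidean_space set"
  assumes W: "subspace W" and Wi: "\<And>x. x \<in> W \<Longrightarrow> \<i> *\<^sub>C x \<in> W" and dimW: "dim W \<le> m"
    and meas: "dim W = m \<Longrightarrow> S \<in> sets (subspace_lebesgue W)"
    and e: "norm e = 1" and u: "u = orth_proj W e"
    and L: "\<And>x. L x = x - inner x e *\<^sub>R e"
    and M: "\<And>x. M x = x - inner x (\<i> *\<^sub>C e) *\<^sub>R \<i> *\<^sub>C e"
  shows "subspace_volume m (M ` L ` W) (M ` L ` S) = ennreal (1 - (norm u)\<^sup>2) * subspace_volume m W S"
    and "dim (M ` L ` W) = m \<Longrightarrow> M ` L ` S \<in> sets (subspace_lebesgue (M ` L ` W))"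
    and "(norm u)\<^sup>2 \<le> 1"
proof -
  note uW = orth_proj_props[OF W, where x = e, folded u]
  note st1 = subspace_volume_step[OF W dimW meas e uW L]
  have lin: "linear L"
    unfolding L by (auto intro!: linearI simp: inner_add_left algebra_simps)
  have LW: "subspace (L ` W)" using lin W by (rule linear_subspace_image)
  have dLW: "dim (L ` W) \<le> m" using dim_image_le[OF lin, of W] dimW by simp
  have iue: "inner (\<i> *\<^sub>C u) e = 0"
    using uW(2)[OF Wi[OF uW(1)]] by (simp add: inner_diff_right inner_ii_self)
  then have "\<i> *\<^sub>C u = L (\<i> *\<^sub>C u)" by (simp add: L)
  then have iu: "\<i> *\<^sub>C u \<in> L ` W" using Wi[OF uW(1)] by blast
  have orth: "inner y (\<i> *\<^sub>C e - \<i> *\<^sub>C u) = 0" if y: "y \<in> L ` W" for y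
  proof -
    obtain x where x: "x \<in> W" "y = L x" using y by blast
    have "inner x (\<i> *\<^sub>C e - \<i> *\<^sub>C u) = 0"
      using uW(2)[OF Wi[OF x(1)]] by (simp add: inner_diff_right inner_ii_swap)
    moreover have "inner e (\<i> *\<^sub>C e - \<i> *\<^sub>C u) = 0"
      using iue inner_ii_self[of e] by (simp add: inner_diff_right inner_commute)
    ultimately show ?thesis by (simp add: x(2) L inner_diff_left)
  qed
  have ie: "norm (\<i> *\<^sub>C e) = 1" using e by (simp add: norm_ii)
  note st2 = subspace_volume_step[OF LW dLW st1(2) ie iu orth M, unfolded norm_ii]
  show le1: "(norm u)\<^sup>2 \<le> 1" by (rule st1(3))
  let ?t = "ennreal (sqrt (1 - (norm u)\<^sup>2))"
  have tt: "?t * ?t = ennreal (1 - (norm u)\<^sup>2)"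
    using le1 by (simp add: ennreal_mult[symmetric])
  have "subspace_volume m (M ` L ` W) (M ` L ` S) = ?t * subspace_volume m (L ` W) (L ` S)"
    by (rule st2(1))
  also have "\<dots> = ?t * (?t * subspace_volume m W S)" using st1(1) by simp
  finally show "subspace_volume m (M ` L ` W) (M ` L ` S) = ennreal (1 - (norm u)\<^sup>2) * subspace_volume m W S"
    by (simp add: mult.assoc[symmetric] tt)
  show "dim (M ` L ` W) = m \<Longrightarrow> M ` L ` S \<in> sets (subspace_lebesgue (M ` L ` W))"
    by (rule st2(2))
qed

text \<open>
  The family with both \<open>e i\<close> (index \<open>(i, False)\<close>) and \<open>\<i> *\<^sub>C e i\<close> (index \<open>(i, True)\<close>). If \<open>e\<close> is
  orthonormal for the Hermitian product, it is orthonormal for the real inner product.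
\<close>
definition realified :: "('i \<Rightarrow> 'a::complex_euclidean_space) \<Rightarrow> 'i \<times> bool \<Rightarrow> 'a" where
  "realified e = (\<lambda>(i, k). if k then \<i> *\<^sub>C e i else e i)"

lemma coord_proj_realified:
  "coord_proj (realified e) (I \<times> UNIV) x = (\<Sum>i\<in>I. cinner (e i) x *\<^sub>C e i)"
proof -
  have "coord_proj (realified e) (I \<times> UNIV) x =
      (\<Sum>i\<in>I. \<Sum>k\<in>UNIV. inner x (realified e (i, k)) *\<^sub>R realified e (i, k))"
    unfolding coord_proj_def by (simp add: sum.cartesian_product split_def)
  also have "\<dots> = (\<Sum>i\<in>I. inner x (e i) *\<^sub>R e i + inner x (\<i> *\<^sub>C e i) *\<^sub>R \<i> *\<^sub>C e i)"
    by (simp add: UNIV_bool realified_def add.commute)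
  also have "\<dots> = (\<Sum>i\<in>I. cinner (e i) x *\<^sub>C e i)"
    by (simp add: scaleC_eq_Re_Im[of "cinner _ _"] Re_cinner inner_ii_left[symmetric] inner_commute)
  finally show ?thesis .
qed

lemma coord_proj_realified_ii:
  "coord_proj (realified e) (I \<times> UNIV) (\<i> *\<^sub>C x) = \<i> *\<^sub>C coord_proj (realified e) (I \<times> UNIV) x"
  unfolding coord_proj_realified complex_vector.scale_sum_right
  by (simp add: cinner_scaleC_right scaleC_scaleC)

lemma inner_realified:
  assumes "\<And>i j. i \<in> I \<Longrightarrow> j \<in> I \<Longrightarrow> cinner (e i) (e j) = (if i = j then 1 else 0)"
    and "k \<in> I \<times> UNIV" "l \<in> I \<times> UNIV"
  shows "inner (realified e k) (realified e l) = (if k = l then 1 else 0)"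
proof -
  obtain i a j b where kl: "k = (i, a)" "l = (j, b)" "i \<in> I" "j \<in> I" using assms(2,3) by auto
  have c: "cinner (e i) (e j) = (if i = j then 1 else 0)" using assms(1) kl(3,4) by blast
  then have "inner (e i) (e j) = (if i = j then 1 else 0)" "Im (cinner (e i) (e j)) = 0"
    by (simp_all add: Re_cinner[symmetric])
  then show ?thesis
    by (auto simp: kl(1,2) realified_def inner_ii_ii inner_ii_left inner_ii_right
        cinner_scaleC_left Re_cinner)
qed

lemma corth_proj_eqI:
  fixes W :: "'a::complex_euclidean_space set"
  assumes W: "complex_vector.subspace W" and w: "w \<in> W" "\<And>u. u \<in> W \<Longrightarrow> cinner u (x - w) = 0"
  shows "corth_proj W x = w"
  unfolding corth_proj_def
proof (rule the_equality)
  show "w \<in> W \<and> (\<forall>u\<in>W. cinner u (x - w) = 0)" using w by simp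
next
  fix w' assume w': "w' \<in> W \<and> (\<forall>u\<in>W. cinner u (x - w') = 0)"
  have W': "subspace W" using W by (rule complex_subspace_imp_subspace)
  have "inner u (x - w) = 0" "inner u (x - w') = 0" if "u \<in> W" for u
    using w(2) w' that by (simp_all add: Re_cinner[symmetric])
  then have "orth_proj W x = w" "orth_proj W x = w'"
    using w(1) w' by (auto intro!: orth_proj_eqI[OF W'])
  then show "w' = w" by simp
qed

lemma corth_proj_UNIV: "corth_proj UNIV x = x"
proof (rule corth_proj_eqI)
  show "cinner u (x - x) = 0" for u by (simp add: cinner_eq_inner complex_eq_iff)
qed simp_all

lemma corth_proj_ccoord_subspace:
  fixes v e :: "nat \<Rightarrow> 'a::complex_euclidean_space"
  assumes I: "finite I"
    and e: "\<And>i j. i \<in> I \<Longrightarrow> j \<in> I \<Longrightarrow> cinner (e i) (e j) = (if i = j then 1 else 0)"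
    and v: "\<And>i. i \<in> I \<Longrightarrow> v i = c i *\<^sub>R e i" "\<And>i. i \<in> I \<Longrightarrow> c i \<noteq> 0"
  shows "corth_proj (ccoord_subspace v I) x = coord_proj (realified e) (I \<times> UNIV) x"
    (is "_ = ?w")
proof (rule corth_proj_eqI)
  show "complex_vector.subspace (ccoord_subspace v I)" by (simp add: ccoord_subspace_def)
  have "e i \<in> complex_vector.span (v ` I)" if "i \<in> I" for i
  proof -
    have "e i = of_real (1 / c i) *\<^sub>C v i"
      unfolding scaleC_of_real using v[OF that] by simp
    then show ?thesis using that by (metis complex_vector.span_base complex_vector.span_scale image_eqI)
  qed
  then show "?w \<in> ccoord_subspace v I"
    unfolding coord_proj_realified ccoord_subspace_def
    by (intro complex_vector.span_sum complex_vector.span_scale)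
  have inner: "inner (realified e k) (x - ?w) = 0" if "k \<in> I \<times> UNIV" for k
  proof -
    have "inner ?w (realified e k) = inner x (realified e k)"
      by (rule coord_proj_inner) (use I that inner_realified[of I e, OF e] in auto)
    then show ?thesis by (simp add: inner_diff_right inner_commute)
  qed
  show "cinner u (x - ?w) = 0" if "u \<in> ccoord_subspace v I" for u
    using that unfolding ccoord_subspace_def
  proof (induction rule: complex_vector.span_induct_alt)
    case base
    show ?case using complex_vector.scale_zero_left[of 0] cinner_scaleC_left[of 0 0 "x - ?w"] by simp
  next
    case (step k y z)
    then obtain i where i: "i \<in> I" "y = v i" by auto
    have "cinner (e i) (x - ?w) = 0"
      using inner[of "(i, False)"] inner[of "(i, True)"] i(1)
      by (simp add: cinner_eq_inner complex_eq_iff realified_def)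
    then have "cinner (v i) (x - ?w) = 0"
      using v(1)[OF i(1)] by (simp add: scaleC_of_real[symmetric] cinner_scaleC_left)
    then show ?case using step i by (simp add: cinner_add_left cinner_scaleC_left)
  qed
qed

lemma volume_eq_sum_complex_projections:
  fixes V S :: "'a::complex_euclidean_space set"
  assumes V: "complex_vector.subspace V" "complex_vector.dim V = p" and pq: "p \<le> q" and qn: "q \<le> n"
    and S: "S \<in> sets (subspace_lebesgue V)" and v: "corthogonal_basis n v"
  shows "subspace_volume (2 * p) V S =
          inverse (of_nat ((n - p) choose (n - q))) *
          (\<Sum>I\<in>multi_indices q n.
             subspace_volume (2 * p) (corth_proj (ccoord_subspace v I) ` V)
                                     (corth_proj (ccoord_subspace v I) ` S))"
proof -
  define e where "e i = v i /\<^sub>R norm (v i)" for i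
  have v0: "v i \<noteq> 0" if "i \<in> {1..n}" for i
    using v that complex_vector.dependent_zero[of "v ` {1..n}"] unfolding corthogonal_basis_def
    by (metis imageI)
  have vo: "cinner (v i) (v j) = 0" if "i \<in> {1..n}" "j \<in> {1..n}" "i \<noteq> j" for i j
    using v that unfolding corthogonal_basis_def by blast
  have ne: "norm (e i) = 1" if "i \<in> {1..n}" for i using v0[OF that] by (simp add: e_def)
  have e: "cinner (e i) (e j) = (if i = j then 1 else 0)" if "i \<in> {1..n}" "j \<in> {1..n}" for i j
  proof (cases "i = j")
    case True
    then show ?thesis using ne[OF that(1)]
      by (simp add: cinner_eq_inner inner_ii_self norm_eq_1 complex_eq_iff)
  next
    case False
    then show ?thesis using vo[OF that]
      by (simp add: e_def scaleC_of_real[symmetric] cinner_scaleC_left cinner_scaleC_right)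
  qed
  have ve: "v i = norm (v i) *\<^sub>R e i" "norm (v i) \<noteq> 0" if "i \<in> {1..n}" for i
    using v0[OF that] by (auto simp: e_def)
  define f where "f = realified e"
  have f: "inner (f k) (f l) = (if k = l then 1 else 0)" if "I \<subseteq> {1..n}" "k \<in> I \<times> UNIV" "l \<in> I \<times> UNIV" for I k l
    unfolding f_def by (rule inner_realified[of I]) (use e that in blast)+
  define P where "P I = coord_proj f (I \<times> UNIV)" for I
  have fin: "finite I" if "I \<subseteq> {1..n}" for I using that finite_subset by blast
  have proj: "corth_proj (ccoord_subspace v I) = P I" if "I \<subseteq> {1..n}" for I
  proof
    fix x
    show "corth_proj (ccoord_subspace v I) x = P I x"
      unfolding P_def f_def using fin[OF that]
      by (rule corth_proj_ccoord_subspace[where c = "\<lambda>i. norm (v i)"]) (use e ve that in blast)+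
  qed
  have "ccoord_subspace v {1..n} = UNIV" using v by (simp add: corthogonal_basis_def ccoord_subspace_def)
  then have full: "P {1..n} = (\<lambda>x. x)"
    using proj[OF subset_refl, symmetric] by (simp add: corth_proj_UNIV fun_eq_iff)
  define D where "D I = subspace_volume (2 * p) (P I ` V) (P I ` S)" for I
  define a where "a I i = (norm (orth_proj (P I ` V) (e i)))\<^sup>2" for I i
  \<comment> \<open>As in the real case, measurability matters only while the real dimension is still \<open>2 * p\<close>.\<close>
  define Q where "Q I \<longleftrightarrow> dim (P I ` V) = 2 * p \<longrightarrow> P I ` S \<in> sets (subspace_lebesgue (P I ` V))" for I
  have W: "subspace (P I ` V)" for I
    unfolding P_def using linear_coord_proj complex_subspace_imp_subspace[OF V(1)]
    by (rule linear_subspace_image)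
  have Wi: "\<i> *\<^sub>C x \<in> P I ` V" if "x \<in> P I ` V" for x I
    using that complex_vector.subspace_scale[OF V(1)]
    by (auto simp: P_def f_def coord_proj_realified_ii[symmetric])
  have dW: "dim (P I ` V) \<le> 2 * p" for I
    using dim_image_le[OF linear_coord_proj, of f "I \<times> UNIV" V] dim_le_complex_dim[of V] V(2)
    by (simp add: P_def)
  have step: "D (I - {i}) = ennreal (1 - a I i) * D I \<and> a I i \<le> 1 \<and> Q (I - {i})"
    if I: "I \<subseteq> {1..n}" "i \<in> I" "Q I" for I i
  proof -
    define L where "L x = x - inner x (e i) *\<^sub>R e i" for x
    define M where "M x = x - inner x (\<i> *\<^sub>C e i) *\<^sub>R \<i> *\<^sub>C e i" for x
    have fi: "f (i, False) = e i" "f (i, True) = \<i> *\<^sub>C e i" by (simp_all add: f_def realified_def)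
    have "P (I - {i}) x = M (L (P I x))" for x
    proof -
      have "(I - {i}) \<times> UNIV = I \<times> UNIV - {(i, False)} - {(i, True)}"
        by (auto simp: UNIV_bool)
      then have "P (I - {i}) x = M (coord_proj f (I \<times> UNIV - {(i, False)}) x)"
        unfolding P_def M_def fi(2)[symmetric]
        by (simp only:) (rule coord_proj_remove; use fin[OF I(1)] I(2) f[OF I(1)] in auto)
      also have "coord_proj f (I \<times> UNIV - {(i, False)}) x = L (P I x)"
        unfolding P_def L_def fi(1)[symmetric]
        by (rule coord_proj_remove; use fin[OF I(1)] I(2) f[OF I(1)] in auto)
      finally show ?thesis .
    qed
    then have img: "P (I - {i}) ` X = M ` L ` P I ` X" for X by (auto simp: image_iff)
    have meas: "P I ` S \<in> sets (subspace_lebesgue (P I ` V))" if "dim (P I ` V) = 2 * p"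
      using I(3) that by (simp add: Q_def)
    have n1: "norm (e i) = 1" using ne I by blast
    note st = subspace_volume_step_complex[OF W Wi dW meas n1 refl L_def M_def, folded a_def]
    show ?thesis using st unfolding D_def Q_def img by simp
  qed
  have Q: "Q I" if "I \<subseteq> {1..n}" for I
    using finite_atLeastAtMost that
  proof (rule remove_induct)
    show "Q {1..n}" unfolding Q_def full using S by simp
  qed (use step in blast)
  have rec: "(\<Sum>i\<in>I. D (I - {i})) = of_nat (card I - p) * D I" if I: "I \<subseteq> {1..n}" "p < card I" for I
  proof (rule sum_remove_weights)
    have "x \<in> P I ` V \<Longrightarrow> coord_proj f (I \<times> UNIV) x = x" for x
      unfolding P_def using coord_proj_idem[of "I \<times> UNIV" f] fin[OF I(1)] f[OF I(1)] by auto
    then have "real (dim (P I ` V)) = (\<Sum>k\<in>I \<times> UNIV. (norm (orth_proj (P I ` V) (f k)))\<^sup>2)"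
      using sum_orth_proj_norms[OF W] by metis
    also have "\<dots> = (\<Sum>i\<in>I. \<Sum>b\<in>UNIV. (norm (orth_proj (P I ` V) (f (i, b))))\<^sup>2)"
      by (simp add: sum.cartesian_product split_def)
    \<comment> \<open>The projections of \<open>e i\<close> and \<open>\<i> *\<^sub>C e i\<close> have the same norm.\<close>
    also have "\<dots> = 2 * (\<Sum>i\<in>I. a I i)"
      using orth_proj_ii[OF W Wi]
      by (simp add: UNIV_bool f_def realified_def a_def norm_ii sum_distrib_left)
    finally show "D I = 0 \<or> (\<Sum>i\<in>I. a I i) = real p"
      by (auto simp: D_def subspace_volume_def)
  qed (use step Q I in auto)
  have "(\<Sum>I\<in>multi_indices q n. D I) = of_nat ((n - p) choose (n - q)) * D {1..n}"
    using rec pq qn by (rule sum_multi_indices_downward)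
  moreover have "D {1..n} = subspace_volume (2 * p) V S" unfolding D_def full by simp
  moreover have "(\<Sum>I\<in>multi_indices q n. D I) = (\<Sum>I\<in>multi_indices q n.
             subspace_volume (2 * p) (corth_proj (ccoord_subspace v I) ` V)
                                     (corth_proj (ccoord_subspace v I) ` S))"
    by (intro sum.cong refl) (simp add: D_def proj multi_indices_def)
  moreover have "0 < (n - p) choose (n - q)" using pq qn by simp
  ultimately show ?thesis using ennreal_inverse_of_nat_cancel by metis
qed

section \<open>The projection formula for volumes\<close>

theorem theorem3p10:
  shows
    "(\<forall>(V :: 'a::euclidean_space set) S v n p q.
        n = dim (UNIV :: 'a set) \<and> subspace V \<and> dim V = p \<and> p \<le> q \<and> 1 \<le> q \<and> q \<le> n \<and>
        S \<in> sets (subspace_lebesgue V) \<and> orthogonal_basis n v \<longrightarrow>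
        (subspace_volume p V S)\<^sup>2 =
          inverse (of_nat ((n - p) choose (n - q))) *
          (\<Sum>I\<in>multi_indices q n.
             (subspace_volume p (orth_proj (coord_subspace v I) ` V)
                                (orth_proj (coord_subspace v I) ` S))\<^sup>2))
     \<and>
     (\<forall>(V :: 'b::complex_euclidean_space set) S v n p q.
        n = complex_vector.dim (UNIV :: 'b set) \<and> complex_vector.subspace V \<and>
        complex_vector.dim V = p \<and> p \<le> q \<and> 1 \<le> q \<and> q \<le> n \<and>
        S \<in> sets (subspace_lebesgue V) \<and> corthogonal_basis n v \<longrightarrow>
        subspace_volume (2 * p) V S =
          inverse (of_nat ((n - p) choose (n - q))) *
          (\<Sum>I\<in>multi_indices q n.
             subspace_volume (2 * p) (corth_proj (ccoord_subspace v I) ` V)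
                                     (corth_proj (ccoord_subspace v I) ` S)))"
proof (intro conjI allI impI)
  fix V S :: "'a set" and v :: "nat \<Rightarrow> 'a" and n p q :: nat
  assume "n = dim (UNIV :: 'a set) \<and> subspace V \<and> dim V = p \<and> p \<le> q \<and> 1 \<le> q \<and> q \<le> n \<and>
    S \<in> sets (subspace_lebesgue V) \<and> orthogonal_basis n v"
  then show "(subspace_volume p V S)\<^sup>2 =
      inverse (of_nat ((n - p) choose (n - q))) *
      (\<Sum>I\<in>multi_indices q n.
         (subspace_volume p (orth_proj (coord_subspace v I) ` V)
                            (orth_proj (coord_subspace v I) ` S))\<^sup>2)"
    by (elim conjE) (rule volume_square_eq_sum_projections)
next
  fix V S :: "'b set" and v :: "nat \<Rightarrow> 'b" and n p q :: nat
  assume "n = complex_vector.dim (UNIV :: 'b set) \<and> complex_vector.subspace V \<and>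
    complex_vector.dim V = p \<and> p \<le> q \<and> 1 \<le> q \<and> q \<le> n \<and>
    S \<in> sets (subspace_lebesgue V) \<and> corthogonal_basis n v"
  then show "subspace_volume (2 * p) V S =
      inverse (of_nat ((n - p) choose (n - q))) *
      (\<Sum>I\<in>multi_indices q n.
         subspace_volume (2 * p) (corth_proj (ccoord_subspace v I) ` V)
                                 (corth_proj (ccoord_subspace v I) ` S))"
    by (elim conjE) (rule volume_eq_sum_complex_projections)
qed

end
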